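(* Let $q$ be a prime power, $m\ne 2$ a positive integer and $n=q^{2m}-1$. Consider a primitive, narrow-sense BCH code of length $n$ over $\mathbf{F}_{q^2}$ with designed distance $\delta$ in the range $2\le\delta\le q^m-1$. If $T$ is a subset of the set $N\setminus\big(\bigcup_{a=1}^{\delta-1}(C_a\cup C_{-qa})\big)$ that is a union of cyclotomic cosets and $r=|T\cup T^{-q}|$ with $0\le r<n-2k$, where $k=m\lceil(\delta-1)(1-1/q^2)\rceil$, then there exists a $$[[q^{2m}-1,\;q^{2m}-1-2m\lceil(\delta-1)(1-1/q^2)\rceil-r,\;r,\;\ge\delta]]_q$$ subsystem code.
   Context: $N=\{0,\dots,n-1\}$; $C_x=\{xq^{2i}\bmod n: i\ge 0\}$ is the cyclotomic coset of $x$ modulo $n$ (over $\mathbf{F}_{q^2}$); $T^{-q}=\{-qt\bmod n: t\in T\}$. The primitive, narrow-sense BCH code of length $n=q^{2m}-1$ over $\mathbf{F}_{q^2}$ with designed distance $\delta$ is the cyclic code whose generator polynomial is $\prod_{t\in Z}(x-\alpha^t)$ with defining set $Z=\bigcup_{a=1}^{\delta-1}C_a$, where $\alpha$ is a primitive $n$-th root of unity over $\mathbf{F}_{q^2}$. Subsystem codes: let $p$ be the characteristic of $\mathbf{F}_q$. For $(x|y)\in\mathbf{F}_q^{2n}$ (with $x,y\in\mathbf{F}_q^n$), $\mathrm{swt}(x|y)$ is the number of $i$ with $(x_i,y_i)\ne(0,0)$, and $\mathrm{swt}(S)$ is the minimum of $\mathrm{swt}$ over the nonzero elements of $S$. The trace-symplectic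 product of $(a|b)$ and $(a'|b')$ is $\mathrm{tr}_{q/p}(a'\cdot b-a\cdot b')$, and $X^{\perp_s}$ is the dual of $X\subseteq\mathbf{F}_q^{2n}$ with respect to it. All subsystem codes are Clifford subsystem codes: an $((n,K,R,d))_q$ subsystem code is a subspace $Q=A\otimes B$ of $\mathbf{C}^{q^n}$, $\dim A=K$, $\dim B=R$, arising from an additive code; concretely, its existence means that there is an additive subgroup $X\le\mathbf{F}_q^{2n}$ (the zero code is allowed) with $Y=X\cap X^{\perp_s}$ such that $|X|=q^nR/K$, $|Y|=q^n/(KR)$, and $d=\mathrm{swt}(Y^{\perp_s}\setminus X)$ if $Y^{\perp_s}\ne X$, while $d=\mathrm{swt}(Y^{\perp_s})$ if $Y^{\perp_s}=X$ (the case $K=1$). $[[n,k,r,d]]_q$ means $((n,q^k,q^r,d))_q$; writing $\ge\delta$ in the last position means that the minimum distance is some $d\ge\delta$. *)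

theory Defs
  imports
    "HOL-Library.Cardinality"
    "HOL-Algebra.Algebraic_Closure_Type"
    "Jordan_Normal_Form.Matrix"
begin

text \<open>Residues are integers in $\{0,\dots,n-1\}$; the index \<open>x\<close> may be any integer, so that
  $C_{-qa}$ makes sense.\<close>

definition cyc_coset :: "nat \<Rightarrow> nat \<Rightarrow> int \<Rightarrow> int set" where
  "cyc_coset q n x = {x * int q ^ (2 * i) mod int n | i. True}"

definition neg_q_image :: "nat \<Rightarrow> nat \<Rightarrow> int set \<Rightarrow> int set" where
  "neg_q_image q n T = (\<lambda>t. (- int q * t) mod int n) ` T"

definition primitive_unity_root :: "nat \<Rightarrow> 'a :: field \<Rightarrow> bool" where
  "primitive_unity_root n z \<longleftrightarrow> n > 0 \<and> z ^ n = 1 \<and> (\<forall>i. 0 < i \<and> i < n \<longrightarrow> z ^ i \<noteq> 1)"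

text \<open>A word $(c_0,\dots,c_{n-1})$ is identified with the polynomial $\sum_i c_i x^i$.\<close>

definition cyclic_code :: "nat \<Rightarrow> 'b :: field poly \<Rightarrow> 'b vec set" where
  "cyclic_code n g = {c \<in> carrier_vec n. g dvd Poly (list_of_vec c)}"

text \<open>Here \<open>'b\<close> is meant to be the field with $q^2$ elements. The root of unity lives in the
  algebraic closure; the product of linear factors has its coefficients in \<open>'b\<close>, since the
  defining set is a union of cyclotomic cosets.\<close>

definition primitive_narrow_sense_bch ::
  "nat \<Rightarrow> nat \<Rightarrow> nat \<Rightarrow> 'b :: finite_field vec set \<Rightarrow> bool" where
  "primitive_narrow_sense_bch q m \<delta> C \<longleftrightarrow>
     (let n = q ^ (2 * m) - 1 in
      CARD('b) = q\<^sup>2 \<and>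
      (\<exists>(\<alpha> :: 'b alg_closure) (g :: 'b poly).
         primitive_unity_root n \<alpha> \<and>
         map_poly to_ac g =
           (\<Prod>t \<in> (\<Union>a \<in> {1..int \<delta> - 1}. cyc_coset q n a). [:- (\<alpha> powi t), 1:]) \<and>
         C = cyclic_code n g))"

text \<open>The absolute trace of the field \<open>'a\<close> down to its prime field, which is regarded as a subset
  of \<open>'a\<close>.\<close>

definition abs_trace :: "'a :: finite_field \<Rightarrow> 'a" where
  "abs_trace x = (\<Sum>i < (THE e. CHAR('a) ^ e = CARD('a)). x ^ (CHAR('a) ^ i))"

definition trace_symplectic ::
  "'a :: finite_field vec \<times> 'a vec \<Rightarrow> 'a vec \<times> 'a vec \<Rightarrow> 'a" where
  "trace_symplectic u v =
     abs_trace (scalar_prod (fst v) (snd u) - scalar_prod (fst u) (snd v))"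

text \<open>A vector $(x|y)$ of length $2n$ is represented by the pair $(x,y)$ of vectors of
  length $n$.\<close>

definition sympl_space :: "nat \<Rightarrow> ('a vec \<times> 'a vec) set" where
  "sympl_space n = carrier_vec n \<times> carrier_vec n"

definition sympl_dual ::
  "nat \<Rightarrow> ('a :: finite_field vec \<times> 'a vec) set \<Rightarrow> ('a vec \<times> 'a vec) set" where
  "sympl_dual n S = {v \<in> sympl_space n. \<forall>u \<in> S. trace_symplectic u v = 0}"

definition additive_code :: "nat \<Rightarrow> ('a :: ring_1 vec \<times> 'a vec) set \<Rightarrow> bool" where
  "additive_code n S \<longleftrightarrow>
     S \<subseteq> sympl_space n \<and> (0\<^sub>v n, 0\<^sub>v n) \<in> S \<and>
     (\<forall>u \<in> S. \<forall>v \<in> S. (fst u + fst v, snd u + snd v) \<in> S) \<and>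
     (\<forall>u \<in> S. (- fst u, - snd u) \<in> S)"

definition swt :: "'a :: zero vec \<times> 'a vec \<Rightarrow> nat" where
  "swt v = card {i. i < dim_vec (fst v) \<and> (fst v $ i, snd v $ i) \<noteq> (0, 0)}"

definition min_swt :: "nat \<Rightarrow> ('a :: zero vec \<times> 'a vec) set \<Rightarrow> nat" where
  "min_swt n S = Inf (swt ` (S - {(0\<^sub>v n, 0\<^sub>v n)}))"

text \<open>An $((n,K,R,d))_q$ Clifford subsystem code $A \otimes B$, with $K = \dim A$ and
  $R = \dim B$, is represented by the additive code \<open>S\<close> it arises from; $q$ is the cardinality
  of \<open>'a\<close>. The case \<open>sympl_dual n Y = S\<close> is the case $K = 1$.\<close>

definition subsystem_code_exists ::
  "'a :: finite_field itself \<Rightarrow> nat \<Rightarrow> nat \<Rightarrow> nat \<Rightarrow> nat \<Rightarrow> bool" where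
  "subsystem_code_exists TA n K R d \<longleftrightarrow>
     K > 0 \<and> R > 0 \<and>
     (\<exists>S :: ('a vec \<times> 'a vec) set. additive_code n S \<and>
        (let q = CARD('a); Y = S \<inter> sympl_dual n S in
         real (card S) = real q ^ n * real R / real K \<and>
         real (card Y) = real q ^ n / (real K * real R) \<and>
         d = (if sympl_dual n Y \<noteq> S then min_swt n (sympl_dual n Y - S)
              else min_swt n (sympl_dual n Y))))"

text \<open>The parameters $[[n,k,r,d]]_q$ stand for $((n,q^k,q^r,d))_q$.\<close>

definition subsystem_code_params_exists ::
  "'a :: finite_field itself \<Rightarrow> nat \<Rightarrow> nat \<Rightarrow> nat \<Rightarrow> nat \<Rightarrow> bool" where
  "subsystem_code_params_exists TA n k r d \<longleftrightarrow>
     subsystem_code_exists TA n (CARD('a) ^ k) (CARD('a) ^ r) d"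

end

theory Submission
  imports Defs "HOL-Algebra.Sylow" "HOL-Algebra.Multiplicative_Group" "HOL-Number_Theory.Cong"
begin

text \<open>Let $U = Z^{-q} \cup T \cup T^{-q}$, where $Z$ is the defining set of the BCH code, and let
  $W(S)$ be the cyclic code over $\mathbf{F}_{q^2}$ whose Fourier transform is supported on $S$. It has
  $q^{2|S|}$ elements: at least that many by multiples of the generator polynomial, and no more since
  $W(S)$ meets $W(N \setminus S)$ trivially. After the identification of $\mathbf{F}_q^{2n}$ with
  $\mathbf{F}_{q^2}^n$ through a basis $1, \beta$, the trace-symplectic form is
  $\mathrm{tr}(\sum_i c_i d_i^q / (\beta - \beta^q))$, and the dual of $W(S)$ is
  $W(N \setminus S^{-q})$. So $X = W(U)$ satisfies $X \cap X^{\perp_s} = W(Z^{-q})$ as soon as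
  $Z \cap Z^{-q} = \emptyset$, the dual of this intersection is the BCH code $W(N \setminus Z)$, and
  the BCH bound gives the distance. Two facts about small residues are needed: for
  $0 < a, b \le q^m - 2$ one never has $n \mid a + b q^l$, whence $Z \cap Z^{-q} = \emptyset$; and
  the cosets of those $a$ with $q^2 \nmid a$ are disjoint and of size $m$, whence the formula for
  $|Z|$.\<close>

text \<open>The fields with q and q^2 elements are two types with no map between them. Both are
  placed in the algebraic closure of the larger one: F_{q^2} as the fixed points of x -> x^(q^2),
  and F_q through an embedding that has to be constructed. Subfields are thus sets, and membership
  in them is checked with Frobenius powers. For the dual, one inclusion is Parseval's identity; the
  other tests a word against the relative traces of u \<alpha>^(-is), where u ranges over
  F_{q^(2m)}. The set U contains Z^{-q} rather than Z because dualising applies S -> S^{-q}, an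
  involution on unions of cosets; this puts the zeros of the dual of W(Z^{-q}) back on Z. The set T
  \<union> T^{-q} is stable under the involution, so it drops out of the intersection with the dual
  and only adds r to |U|. From |X| = q^(2|Z| + 2r) = q^n R / K with R = q^r one reads off K = q^(n -
  2|Z| - r).\<close>

section \<open>Ring homomorphisms applied to coefficients\<close>

lemma map_poly_hom_add:
  assumes "h 0 = 0" "\<And>x y. h (x + y) = h x + h y"
  shows "map_poly h (p + q) = map_poly h p + map_poly h q"
  by (intro poly_eqI) (simp add: coeff_map_poly assms)

text \<open>The homomorphism laws are premises because both \<open>of_int\<close> and the Frobenius
  power x -> x^(q^2) are inserted for \<open>h\<close>.\<close>

lemma map_poly_hom_mult:
  fixes h :: "'a :: comm_ring_1 \<Rightarrow> 'b :: comm_ring_1"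
  assumes "h 0 = 0" "\<And>x y. h (x + y) = h x + h y" "\<And>x y. h (x * y) = h x * h y"
  shows "map_poly h (p * q) = map_poly h p * map_poly h q"
proof (rule poly_eqI)
  fix n
  have "h (sum f A) = (\<Sum>i\<in>A. h (f i))" for f and A :: "nat set"
    by (induction A rule: infinite_finite_induct) (simp_all add: assms)
  then show "coeff (map_poly h (p * q)) n = coeff (map_poly h p * map_poly h q) n"
    by (simp add: coeff_map_poly assms coeff_mult)
qed

lemma map_poly_hom_prod:
  fixes h :: "'a :: comm_ring_1 \<Rightarrow> 'b :: comm_ring_1"
  assumes "h 0 = 0" "h 1 = 1" "\<And>x y. h (x + y) = h x + h y" "\<And>x y. h (x * y) = h x * h y"
  shows "map_poly h (\<Prod>i\<in>I. f i) = (\<Prod>i\<in>I. map_poly h (f i))"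
  by (induction I rule: infinite_finite_induct)
     (simp_all add: map_poly_hom_mult[OF assms(1,3,4)] assms(2) map_poly_1)

lemma poly_eq_sum_lessThan:
  fixes p :: "'a :: comm_ring_1 poly"
  assumes "\<And>i. i \<ge> n \<Longrightarrow> coeff p i = 0"
  shows "poly p x = (\<Sum>i<n. coeff p i * x ^ i)"
proof -
  have "poly p x = (\<Sum>i\<le>degree p. coeff p i * x ^ i)"
    by (rule poly_altdef)
  also have "\<dots> = (\<Sum>i<n + Suc (degree p). coeff p i * x ^ i)"
    by (rule sum.mono_neutral_left) (auto simp: coeff_eq_0)
  also have "\<dots> = (\<Sum>i<n. coeff p i * x ^ i)"
    by (rule sum.mono_neutral_right) (auto simp: assms)
  finally show ?thesis .
qed

section \<open>Finite fields and their embeddings\<close>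

text \<open>An integer polynomial can be evaluated in two rings of the same characteristic, which
  allows an element of one field to be compared with an element of another.\<close>

definition int_eval :: "int poly \<Rightarrow> 'a :: comm_ring_1 \<Rightarrow> 'a" where
  "int_eval P x = poly (map_poly of_int P) x"

lemma int_eval_simps [simp]:
  "int_eval (P + Q) x = int_eval P x + int_eval Q x"
  "int_eval (P - Q) x = int_eval P x - int_eval Q x"
  "int_eval (P * Q) x = int_eval P x * int_eval Q x"
  "int_eval (smult c P) x = of_int c * int_eval P x"
  "int_eval (monom c n) x = of_int c * x ^ n"
  "int_eval 0 x = 0"
  "int_eval 1 x = 1"
proof -
  show add: "int_eval (P + Q) x = int_eval P x + int_eval Q x" for P Q :: "int poly"
    by (simp add: int_eval_def map_poly_hom_add)
  show mult: "int_eval (P * Q) x = int_eval P x * int_eval Q x" for P Q :: "int poly"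
    by (simp add: int_eval_def map_poly_hom_mult)
  show monom: "int_eval (monom c n) x = of_int c * x ^ n" for c n
    by (simp add: int_eval_def map_poly_monom poly_monom)
  show "int_eval (smult c P) x = of_int c * int_eval P x"
    using mult[of "monom c 0" P] monom[of c 0] by (simp add: smult_monom monom_0)
  show "int_eval (P - Q) x = int_eval P x - int_eval Q x"
    using add[of "P - Q" Q] by simp
qed (simp_all add: int_eval_def)

text \<open>Modulo $p$, the polynomial \<open>f\<close> is the minimal polynomial of \<open>g\<close> over the prime field;
  working with integer polynomials avoids a type for that field.\<close>

lemma int_eval_vanishing_transfer:
  fixes g :: "'a :: comm_ring_1" and \<rho> :: "'c :: comm_ring_1"
  assumes char: "CHAR('a) = p" "CHAR('c) = p" "prime p"
    and f: "lead_coeff f = 1" "int_eval f g = 0" "int_eval f \<rho> = 0"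
    and min: "\<And>h. lead_coeff h = 1 \<Longrightarrow> int_eval h g = 0 \<Longrightarrow> degree f \<le> degree h"
    and P: "int_eval P g = 0"
  shows "int_eval P \<rho> = 0"
  using P
proof (induction "degree P" arbitrary: P rule: less_induct)
  case less
  have p0: "of_int (int p * k) = (0 :: 'a)" "of_int (int p * k) = (0 :: 'c)" for k
    using char of_nat_CHAR[where ?'a = 'a] of_nat_CHAR[where ?'a = 'c] by simp_all
  \<comment> \<open>Subtracting a polynomial with the same leading term that vanishes at both points
    lowers the degree; in degree 0 nothing is left.\<close>
  have reduce: "int_eval P \<rho> = 0"
    if M: "int_eval M g = 0" "int_eval M \<rho> = 0" "degree M = degree P"
      "lead_coeff M = lead_coeff P" for M
  proof (cases "degree P = 0")
    case True
    then have "P = M"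
      using M by (metis degree_0_id)
    then show ?thesis using M by simp
  next
    case False
    have "degree (P - M) \<le> degree P"
      using M(3) by (intro degree_diff_le) auto
    moreover have "coeff (P - M) (degree P) = 0"
      using M(3,4) by simp
    ultimately have "degree (P - M) < degree P"
      using False by (metis degree_0 eq_zero_or_degree_less gr0I)
    moreover have "int_eval (P - M) g = 0"
      using less.prems M by simp
    ultimately have "int_eval (P - M) \<rho> = 0"
      using less.hyps by blast
    then show ?thesis using M by simp
  qed
  show ?case
  proof (cases "degree f \<le> degree P \<and> P \<noteq> 0")
    case True
    let ?M = "monom (lead_coeff P) (degree P - degree f) * f"
    have f0: "f \<noteq> 0" using f(1) by auto
    have "degree ?M = degree P"
      using True f0 by (subst degree_mult_eq) (auto simp: degree_monom_eq)
    moreover have "lead_coeff ?M = lead_coeff P"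
      using f(1) True by (simp add: lead_coeff_mult degree_monom_eq)
    ultimately show ?thesis
      using f by (intro reduce[of ?M]) simp_all
  next
    case False
    have "int p dvd lead_coeff P"
    proof (rule ccontr)
      assume "\<not> int p dvd lead_coeff P"
      then have "coprime (lead_coeff P) (int p)"
        using char(3) by (metis coprime_commute prime_imp_coprime prime_nat_int_transfer)
      \<comment> \<open>If the leading coefficient is a unit modulo p, a multiple of
        \<open>P\<close>, corrected by a multiple of p, is monic and still vanishes at
        \<open>g\<close>; the minimality of \<open>f\<close> excludes this.\<close>
      then obtain u v where uv: "u * lead_coeff P + v * int p = 1"
        by (metis bezout_int coprime_imp_gcd_eq_1)
      let ?h = "smult u P + monom (int p * v) (degree P)"
      have c: "coeff ?h (degree P) = 1"
        using uv by (simp add: algebra_simps)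
      have "degree ?h \<le> degree P"
        by (intro degree_add_le) (auto simp: degree_monom_le intro: degree_smult_le)
      then have d: "degree ?h = degree P"
        using c by (metis antisym le_degree zero_neq_one)
      have "int_eval ?h g = 0"
        using less.prems p0(1)[of v] by (simp del: of_int_mult)
      then have "degree f \<le> degree P"
        using min[of ?h] c d by simp
      then have "P = 0" using False by auto
      then show False using \<open>\<not> int p dvd lead_coeff P\<close> by simp
    qed
    then obtain k where k: "lead_coeff P = int p * k" by (auto simp: dvd_def)
    have "degree (monom (lead_coeff P) (degree P)) = degree P"
      by (cases "P = 0") (simp_all add: degree_monom_eq)
    moreover have "int_eval (monom (lead_coeff P) (degree P)) g = 0"
         "int_eval (monom (lead_coeff P) (degree P)) \<rho> = 0"
      unfolding k by (simp_all add: p0 del: of_int_mult)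
    ultimately show ?thesis
      by (intro reduce[of "monom (lead_coeff P) (degree P)"]) simp_all
  qed
qed

lemma finite_field_generator:
  obtains g :: "'a :: finite_field" where "\<And>x. x \<noteq> 0 \<Longrightarrow> \<exists>i. x = g ^ i"
proof -
  define R where "R = (ring_of_type_algebra :: 'a ring)"
  interpret R: field R
    unfolding R_def by (rule field_from_type_algebra)
  have R: "carrier R = UNIV" "\<And>x y. x \<otimes>\<^bsub>R\<^esub> y = x * y" "\<zero>\<^bsub>R\<^esub> = 0" "\<one>\<^bsub>R\<^esub> = 1"
    by (simp_all add: R_def ring_of_type_algebra_def)
  have pow: "x [^]\<^bsub>R\<^esub> (i :: nat) = x ^ i" for x i
    by (induction i) (simp_all add: R mult.commute)
  obtain g where "carrier (mult_of R) = {g [^]\<^bsub>R\<^esub> i | i :: nat. i \<in> UNIV}"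
    using R.finite_field_mult_group_has_gen by (auto simp: R(1))
  then have "UNIV - {0} = {g ^ i | i. True}"
    by (simp add: pow R)
  then show ?thesis using that[of g] by blast
qed

text \<open>Zero and the powers of \<open>g\<close> are values at \<open>g\<close> of integer
  polynomials. The map sends such a value to the value of the same polynomial at a root
  \<open>\<rho>\<close> of \<open>f\<close>; by \<open>int_eval_vanishing_transfer\<close> the
  choice of polynomial does not matter, and the homomorphism laws follow.\<close>

lemma finite_field_embedding:
  assumes "CHAR('a :: finite_field) = CHAR('c :: alg_closed_field)"
  obtains \<phi> :: "'a :: finite_field \<Rightarrow> 'c :: alg_closed_field" where "\<phi> 0 = 0" "\<phi> 1 = 1" "\<And>x y. \<phi> (x + y) = \<phi> x + \<phi> y"
    "\<And>x y. \<phi> (x * y) = \<phi> x * \<phi> y" "inj \<phi>"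
proof -
  obtain g :: 'a where g: "\<And>x. x \<noteq> 0 \<Longrightarrow> \<exists>i. x = g ^ i"
    by (rule finite_field_generator) blast
  define rep where "rep x = (SOME P. int_eval P g = x)" for x
  have rep: "int_eval (rep x) g = x" for x
  proof -
    have "\<exists>P. int_eval P g = x"
    proof (cases "x = 0")
      case True
      then show ?thesis by (intro exI[of _ 0]) simp
    next
      case False
      then obtain i where "x = g ^ i" using g by blast
      then show ?thesis by (intro exI[of _ "monom 1 i"]) simp
    qed
    then show ?thesis unfolding rep_def by (rule someI_ex)
  qed
  define monic_vanishing where
    "monic_vanishing h \<longleftrightarrow> lead_coeff h = 1 \<and> int_eval h g = 0" for h :: "int poly"
  have "CARD('a) > 1"
    using card_mono[of UNIV "{0, 1 :: 'a}"] by simp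
  then have deg: "degree (monom 1 CARD('a) + monom (- 1) 1 :: int poly) = CARD('a)"
    by (subst degree_add_eq_left) (auto simp: degree_monom_eq)
  \<comment> \<open>X^q - X with q the size of the field vanishes at every element, so a monic
    polynomial of least degree vanishing at \<open>g\<close> exists.\<close>
  then have "monic_vanishing (monom 1 CARD('a) + monom (- 1) 1)"
    using \<open>CARD('a) > 1\<close> by (simp add: monic_vanishing_def finite_field_power_card_eq_same)
  then obtain f where f: "monic_vanishing f"
    and min: "\<And>h. monic_vanishing h \<Longrightarrow> degree f \<le> degree h"
    using ex_has_least_nat[of monic_vanishing _ degree] by metis
  have "degree f > 0"
  proof (rule ccontr)
    assume "\<not> degree f > 0"
    then have "f = 1"
      using f unfolding monic_vanishing_def by (metis degree_0_id neq0_conv one_pCons)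
    then show False using f by (simp add: monic_vanishing_def)
  qed
  have "degree (map_poly of_int f :: 'c poly) = degree f"
    using f by (intro map_poly_degree_eq) (simp add: monic_vanishing_def)
  then have "\<exists>\<rho>. poly (map_poly of_int f :: 'c poly) \<rho> = 0"
    using \<open>degree f > 0\<close> by (intro alg_closed_imp_poly_has_root) simp
  then obtain \<rho> :: 'c where \<rho>: "int_eval f \<rho> = 0"
    by (auto simp: int_eval_def)
  have transfer: "int_eval P \<rho> = 0" if "int_eval P g = 0" for P
  proof (rule int_eval_vanishing_transfer[where f = f and g = g and p = "CHAR('a)"])
    show "degree f \<le> degree h" if "lead_coeff h = 1" "int_eval h g = 0" for h
      using min[of h] that by (simp add: monic_vanishing_def)
  qed (use assms[symmetric] f \<rho> that in \<open>simp_all add: monic_vanishing_def\<close>)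
  define \<phi> where "\<phi> x = int_eval (rep x) \<rho>" for x
  have \<phi>I: "\<phi> (int_eval P g) = int_eval P \<rho>" for P
    using transfer[of "rep (int_eval P g) - P"] by (simp add: \<phi>_def rep)
  show ?thesis
  proof
    show 0: "\<phi> 0 = 0" using \<phi>I[of 0] by simp
    show 1: "\<phi> 1 = 1" using \<phi>I[of 1] by simp
    show add: "\<phi> (x + y) = \<phi> x + \<phi> y" for x y
      using \<phi>I[of "rep x + rep y"] by (simp add: rep \<phi>_def)
    show mult: "\<phi> (x * y) = \<phi> x * \<phi> y" for x y
      using \<phi>I[of "rep x * rep y"] by (simp add: rep \<phi>_def)
    show "inj \<phi>"
    proof (rule injI, rule ccontr)
      fix x y assume "\<phi> x = \<phi> y" "x \<noteq> y"
      then have "\<phi> (x - y) = 0"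
        using add[of "x - y" y] by simp
      then have "\<phi> ((x - y) * inverse (x - y)) = 0"
        by (simp add: mult)
      then show False
        using \<open>x \<noteq> y\<close> 1 by simp
    qed
  qed
qed

text \<open>Cauchy's theorem for the additive group, obtained as Sylow's theorem with exponent 1: a
  subgroup of order \<open>l\<close> contains some x \<noteq> 0 with l x = 0, and cancelling x gives
  l = 0 in the field.\<close>

lemma prime_dvd_CARD_imp_CHAR:
  assumes "prime l" "l dvd CARD('a :: finite_field)"
  shows "l = CHAR('a)"
proof -
  define G where "G = add_monoid (ring_of_type_algebra :: 'a ring)"
  interpret R: field "ring_of_type_algebra :: 'a ring"
    by (rule field_from_type_algebra)
  interpret G: group G
    unfolding G_def by (rule R.a_group)
  have G: "carrier G = UNIV" "\<And>x y. x \<otimes>\<^bsub>G\<^esub> y = x + y" "\<one>\<^bsub>G\<^esub> = 0"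
    by (simp_all add: G_def ring_of_type_algebra_def)
  have pow: "x [^]\<^bsub>G\<^esub> (i :: nat) = of_nat i * x" for x i
    by (induction i) (simp_all add: G algebra_simps)
  obtain k where "CARD('a) = l ^ 1 * k"
    using assms(2) by (auto simp: dvd_def)
  then obtain H where H: "subgroup H G" "card H = l ^ 1"
    using sylow_thm[of l G 1 k] assms(1) G.is_group by (auto simp: Coset.order_def G)
  have "\<not> H \<subseteq> {0}"
    using H(2) prime_gt_1_nat[OF assms(1)] card_mono[of "{0}" H] by auto
  then obtain x where x: "x \<in> H" "x \<noteq> 0" by auto
  have "x [^]\<^bsub>G\<lparr>carrier := H\<rparr>\<^esub> Coset.order (G\<lparr>carrier := H\<rparr>) = \<one>\<^bsub>G\<lparr>carrier := H\<rparr>\<^esub>"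
    using group.pow_order_eq_1[OF subgroup.subgroup_is_group[OF H(1) G.is_group]] x by simp
  then have "x [^]\<^bsub>G\<^esub> l = 0"
    using H(2) by (simp add: Coset.order_def G flip: G.nat_pow_consistent)
  then have "of_nat l = (0 :: 'a)"
    using x by (simp add: pow)
  then have "CHAR('a) dvd l"
    by (simp add: of_nat_eq_0_iff_char_dvd)
  then show ?thesis
    using assms(1) CHAR_prime[where ?'a = 'a] by (metis prime_nat_iff primes_dvd_imp_eq)
qed

lemma CARD_finite_field_CHAR_power:
  obtains e where "CARD('a :: finite_field) = CHAR('a) ^ e" "e > 0"
proof -
  have "prime_factors CARD('a) \<subseteq> {CHAR('a)}"
    by (blast dest: in_prime_factors_imp_prime in_prime_factors_imp_dvd prime_dvd_CARD_imp_CHAR)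
  then have "prime_factors CARD('a) = {} \<or> prime_factors CARD('a) = {CHAR('a)}"
    by (rule subset_singletonD)
  then have "\<exists>e. CARD('a) = CHAR('a) ^ e"
    using prime_factorization_nat[of "CARD('a)"] by (auto intro: exI[of _ 0])
  moreover have "CARD('a) > 1"
    using card_mono[of UNIV "{0, 1 :: 'a}"] by simp
  ultimately show ?thesis
    using that by (metis less_irrefl not_gr_zero power_0)
qed

section \<open>Cyclic codes over the field with $q^2$ elements\<close>

text \<open>Serves two counts: the words of length n, and the cofactors of degree less than |S| that
  multiply a generator polynomial.\<close>

lemma card_polys_coeffs_in:
  fixes F :: "'a :: comm_ring_1 set"
  assumes "finite F" "0 \<in> F"
  shows "card {c. (\<forall>i. coeff c i \<in> F) \<and> (\<forall>i\<ge>d. coeff c i = 0)} = card F ^ d"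
    and "finite {c. (\<forall>i. coeff c i \<in> F) \<and> (\<forall>i\<ge>d. coeff c i = 0)}"
proof -
  let ?P = "{c. (\<forall>i. coeff c i \<in> F) \<and> (\<forall>i\<ge>d. coeff c i = 0)}"
  have cf: "coeff (\<Sum>i<d. monom (f i) i) j = (if j < d then f j else 0)"
    for f :: "nat \<Rightarrow> 'a" and j
    by (simp add: coeff_sum)
  have bij: "bij_betw (\<lambda>c. restrict (coeff c) {..<d}) ?P ({..<d} \<rightarrow>\<^sub>E F)"
  proof (rule bij_betwI[where g = "\<lambda>f. \<Sum>i<d. monom (f i) i"])
    show "(\<lambda>c. restrict (coeff c) {..<d}) \<in> ?P \<rightarrow> ({..<d} \<rightarrow>\<^sub>E F)"
      by (intro Pi_I restrict_PiE_iff[THEN iffD2]) simp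
    show "(\<lambda>f. \<Sum>i<d. monom (f i) i) \<in> ({..<d} \<rightarrow>\<^sub>E F) \<rightarrow> ?P"
      using assms by (intro Pi_I) (simp add: cf PiE_iff)
    show "(\<Sum>i<d. monom (restrict (coeff c) {..<d} i) i) = c" if "c \<in> ?P" for c
      using that by (intro poly_eqI) (simp add: cf)
    show "restrict (coeff (\<Sum>i<d. monom (f i) i)) {..<d} = f" if f: "f \<in> {..<d} \<rightarrow>\<^sub>E F" for f
    proof (rule PiE_ext[OF _ f])
      show "restrict (coeff (\<Sum>i<d. monom (f i) i)) {..<d} \<in> {..<d} \<rightarrow>\<^sub>E F"
        using f by (intro restrict_PiE_iff[THEN iffD2]) (simp add: cf PiE_iff)
      show "restrict (coeff (\<Sum>i<d. monom (f i) i)) {..<d} i = f i" if "i \<in> {..<d}" for i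
        using that by (simp add: cf)
    qed
  qed
  show "card ?P = card F ^ d"
    unfolding bij_betw_same_card[OF bij] by (subst card_PiE) simp_all
  show "finite ?P"
    unfolding bij_betw_finite[OF bij] using assms by (intro finite_PiE) simp_all
qed

lemma mult_mod_mult_mod: "(x * a mod N) * b mod N = x * (a * b) mod (N :: int)"
  by (metis mod_mult_left_eq mult.assoc)

lemma degree_less_if_coeffs_zero:
  assumes "c \<noteq> 0" "\<And>i. i \<ge> d \<Longrightarrow> coeff c i = 0"
  shows "degree c < d"
proof (rule ccontr)
  assume "\<not> degree c < d"
  then have "lead_coeff c = 0" by (intro assms(2)) simp
  then show False using assms(1) by simp
qed

lemma primitive_unity_root_powi_eq_iff:
  fixes \<alpha> :: "'c :: field"
  assumes "primitive_unity_root n \<alpha>"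
  shows "\<alpha> powi a = \<alpha> powi b \<longleftrightarrow> a mod int n = b mod int n"
proof -
  from assms have n: "n > 0" "\<alpha> ^ n = 1" and prim: "\<And>i. 0 < i \<Longrightarrow> i < n \<Longrightarrow> \<alpha> ^ i \<noteq> 1"
    by (auto simp: primitive_unity_root_def)
  have \<alpha>: "\<alpha> \<noteq> 0" using n by (metis power_eq_0_iff zero_neq_one)
  have red: "\<alpha> powi a = \<alpha> ^ nat (a mod int n)" for a
  proof -
    have "\<alpha> powi a = \<alpha> powi (int n * (a div int n) + a mod int n)"
      by simp
    also have "\<dots> = (\<alpha> powi int n) powi (a div int n) * \<alpha> powi (a mod int n)"
      using \<alpha> by (simp only: power_int_add power_int_mult simp_thms)
    also have "\<dots> = \<alpha> powi (a mod int n)" using n by simp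
    finally show ?thesis using n by (simp add: power_int_nonneg_exp)
  qed
  have less: "\<alpha> ^ i \<noteq> \<alpha> ^ j" if "i < j" "j < n" for i j
  proof
    assume "\<alpha> ^ i = \<alpha> ^ j"
    moreover have "\<alpha> ^ j = \<alpha> ^ i * \<alpha> ^ (j - i)"
      using that by (simp flip: power_add)
    ultimately show False using \<alpha> prim[of "j - i"] that by simp
  qed
  have inj: "i = j" if "\<alpha> ^ i = \<alpha> ^ j" "i < n" "j < n" for i j
    using that less[of i j] less[of j i] by (cases i j rule: linorder_cases) auto
  have "nat (a mod int n) < n" "nat (b mod int n) < n"
    using n by (simp_all add: nat_less_iff)
  then have "\<alpha> powi a = \<alpha> powi b \<longleftrightarrow> nat (a mod int n) = nat (b mod int n)"
    unfolding red using inj[of "nat (a mod int n)" "nat (b mod int n)"] by auto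
  then show ?thesis using n by (simp add: eq_nat_nat_iff)
qed

text \<open>\<open>'c\<close> will be an algebraic closure; the fixed points counted by
  \<open>card_base\<close> are then the field with q^2 elements. The exponent \<open>e\<close> is a
  parameter because it fixes the number of conjugates in a trace.\<close>

locale bch_field =
  fixes \<alpha> :: "'c :: field" and q m n e :: nat
  assumes char_prime: "prime CHAR('c)"
    and q_eq: "q = CHAR('c) ^ e" and e_pos: "e > 0"
    and m_pos: "m > 0"
    and n_eq: "n = q ^ (2 * m) - 1"
    and primitive: "primitive_unity_root n \<alpha>"
    and card_base: "card {x :: 'c. x ^ q\<^sup>2 = x} = q\<^sup>2"
begin

lemma q_gt_1: "q > 1"
  unfolding q_eq using prime_gt_1_nat[OF char_prime] e_pos by (intro one_less_power)

lemma n_pos: "n > 0"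
  using primitive by (simp add: primitive_unity_root_def)

lemma Suc_n: "Suc n = (q\<^sup>2) ^ m"
  using q_gt_1 by (simp add: n_eq power_mult)

lemma alpha_nonzero [simp]: "\<alpha> \<noteq> 0"
  using primitive by (metis power_eq_0_iff primitive_unity_root_def zero_neq_one)

lemmas powi_eq_iff = primitive_unity_root_powi_eq_iff[OF primitive]

lemma powi_power: "(\<alpha> powi t) ^ k = \<alpha> powi (t * int k)"
  by (rule power_int_power')

lemma sum_power_q2: "(\<Sum>i\<in>A. f i :: 'c) ^ ((q\<^sup>2) ^ k) = (\<Sum>i\<in>A. f i ^ ((q\<^sup>2) ^ k))"
  by (rule freshmans_dream_sum'[OF char_prime, of _ "2 * e * k"])
     (simp add: q_eq mult.commute flip: power_mult)

lemma sum_power_q: "(\<Sum>i\<in>A. f i :: 'c) ^ q = (\<Sum>i\<in>A. f i ^ q)"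
  by (rule freshmans_dream_sum'[OF char_prime q_eq])

lemma sum_power_char: "(\<Sum>i\<in>A. f i :: 'c) ^ (CHAR('c) ^ k) = (\<Sum>i\<in>A. f i ^ (CHAR('c) ^ k))"
  by (rule freshmans_dream_sum'[OF char_prime refl])

lemma power_q2_add: "(x + y :: 'c) ^ q\<^sup>2 = x ^ q\<^sup>2 + y ^ q\<^sup>2"
  by (rule freshmans_dream'[OF char_prime, of _ "e * 2"]) (simp add: q_eq power_mult)

lemma power_q2_zero [simp]: "(0 :: 'c) ^ q\<^sup>2 = 0"
  using q_gt_1 by simp

lemma base_power:
  assumes "(x :: 'c) ^ q\<^sup>2 = x"
  shows "x ^ ((q\<^sup>2) ^ k) = x"
  by (induction k) (simp_all add: power_mult assms)

lemma powi_q2_m: "(\<alpha> powi t) ^ ((q\<^sup>2) ^ m) = \<alpha> powi t"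
  unfolding powi_power powi_eq_iff by (simp flip: Suc_n add: algebra_simps)

lemma of_nat_n: "of_nat n = (- 1 :: 'c)"
proof -
  have "CHAR('c) dvd Suc n"
    unfolding Suc_n q_eq using e_pos m_pos by (simp add: dvd_power flip: power_mult)
  then have "of_nat (Suc n) = (0 :: 'c)"
    by (simp only: of_nat_eq_0_iff_char_dvd)
  then show ?thesis by (simp add: add_eq_0_iff)
qed

definition words :: "'c poly set" where
  "words = {c. (\<forall>i. coeff c i \<in> {x. x ^ q\<^sup>2 = x}) \<and> (\<forall>i\<ge>n. coeff c i = 0)}"

text \<open>\<open>S\<close> is the complement of the defining set. Indexing by the support makes
  codes monotone in \<open>S\<close> and turns their intersections into intersections of
  supports.\<close>

definition code :: "int set \<Rightarrow> 'c poly set" where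
  "code S = {c \<in> words. \<forall>t \<in> {0..<int n} - S. poly c (\<alpha> powi t) = 0}"

text \<open>One multiplication by q^2 suffices: as q^(2m) = 1 modulo n, iterating it undoes it, so
  such a set is a union of full cosets.\<close>

definition coset_closed :: "int set \<Rightarrow> bool" where
  "coset_closed S \<longleftrightarrow> S \<subseteq> {0..<int n} \<and> (\<forall>t\<in>S. t * int (q\<^sup>2) mod int n \<in> S)"

lemma finite_base: "finite {x :: 'c. x ^ q\<^sup>2 = x}"
  using card_base q_gt_1 by (metis card.infinite power_eq_0_iff less_nat_zero_code)

lemma card_words: "card words = (q\<^sup>2) ^ n" and finite_words: "finite words"
  unfolding words_def using card_polys_coeffs_in[OF finite_base, of n] card_base by simp_all

lemma code_subset_words: "code S \<subseteq> words"
  by (auto simp: code_def)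

lemma finite_code: "finite (code S)"
  using finite_words code_subset_words finite_subset by blast

lemma words_poly: "c \<in> words \<Longrightarrow> poly c x = (\<Sum>i<n. coeff c i * x ^ i)"
  by (rule poly_eq_sum_lessThan) (simp add: words_def)

lemma words_add: "c \<in> words \<Longrightarrow> d \<in> words \<Longrightarrow> c + d \<in> words"
  by (auto simp: words_def power_q2_add)

lemma minus_power_q2: "(- x :: 'c) ^ q\<^sup>2 = - (x ^ q\<^sup>2)"
  using power_q2_add[of x "- x"] by (simp add: add_eq_0_iff2)

lemma words_diff: "c \<in> words \<Longrightarrow> d \<in> words \<Longrightarrow> c - d \<in> words"
  using words_add[of c "- d"] by (auto simp: words_def minus_power_q2)

lemma code_add: "c \<in> code S \<Longrightarrow> d \<in> code S \<Longrightarrow> c + d \<in> code S"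
  by (auto simp: code_def words_add)

lemma code_diff: "c \<in> code S \<Longrightarrow> d \<in> code S \<Longrightarrow> c - d \<in> code S"
  by (auto simp: code_def words_diff)

lemma zero_in_code: "0 \<in> code S"
  by (simp add: code_def words_def)

lemma words_eq_zeroI:
  assumes "c \<in> words" "\<And>t. t \<in> {0..<int n} \<Longrightarrow> poly c (\<alpha> powi t) = 0"
  shows "c = 0"
proof (rule ccontr)
  assume "c \<noteq> 0"
  have "inj_on (\<lambda>t. \<alpha> powi t) {0..<int n}"
    by (auto simp: inj_on_def powi_eq_iff)
  then have "n = card ((\<lambda>t. \<alpha> powi t) ` {0..<int n})"
    by (simp add: card_image)
  also have "\<dots> \<le> card {x. poly c x = 0}"
    using assms(2) \<open>c \<noteq> 0\<close> by (intro card_mono poly_roots_finite) auto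
  also have "\<dots> \<le> degree c"
    by (rule card_poly_roots_bound) fact
  also have "degree c < n"
    using assms(1) \<open>c \<noteq> 0\<close> by (intro degree_less_if_coeffs_zero) (auto simp: words_def)
  finally show False by simp
qed

lemma coset_closed_power: "coset_closed S \<Longrightarrow> t \<in> S \<Longrightarrow> t * int ((q\<^sup>2) ^ j) mod int n \<in> S"
proof (induction j)
  case 0
  then show ?case by (auto simp: coset_closed_def subset_iff)
next
  case (Suc j)
  then have "(t * int ((q\<^sup>2) ^ j) mod int n) * int (q\<^sup>2) mod int n \<in> S"
    by (auto simp: coset_closed_def)
  then show ?case by (simp only: mult_mod_mult_mod power_Suc2 of_nat_mult)
qed

lemma bij_mult_q2:
  assumes "coset_closed S"
  shows "bij_betw (\<lambda>t. t * int (q\<^sup>2) mod int n) S S"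
proof -
  have fin: "finite S"
    using assms finite_subset by (auto simp: coset_closed_def)
  have "inj_on (\<lambda>t. t * int (q\<^sup>2) mod int n) S"
  proof (rule inj_onI)
    fix s t assume st: "s \<in> S" "t \<in> S" "s * int (q\<^sup>2) mod int n = t * int (q\<^sup>2) mod int n"
    have "(x * int (q\<^sup>2) mod int n) * int ((q\<^sup>2) ^ (m - 1)) mod int n = x" if "x \<in> S" for x
    proof -
      have "(x * int (q\<^sup>2) mod int n) * int ((q\<^sup>2) ^ (m - 1)) mod int n
          = x * int ((q\<^sup>2) ^ Suc (m - 1)) mod int n"
        by (simp add: mult_mod_mult_mod)
      also have "int ((q\<^sup>2) ^ Suc (m - 1)) = int n + 1"
        using m_pos by (simp flip: Suc_n)
      also have "x * (int n + 1) mod int n = x"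
        using that assms by (auto simp: coset_closed_def algebra_simps subset_iff)
      finally show ?thesis .
    qed
    then show "s = t" using st by metis
  qed
  moreover have "(\<lambda>t. t * int (q\<^sup>2) mod int n) ` S \<subseteq> S"
    using assms by (auto simp: coset_closed_def)
  ultimately show ?thesis
    using endo_inj_surj[OF fin] by (auto simp: bij_betw_def)
qed

lemma coset_closed_Diff:
  assumes "coset_closed S" "coset_closed S'"
  shows "coset_closed (S' - S)"
  unfolding coset_closed_def
proof (intro conjI ballI)
  fix t assume t: "t \<in> S' - S"
  show "t * int (q\<^sup>2) mod int n \<in> S' - S"
  proof
    show "t * int (q\<^sup>2) mod int n \<in> S'" using t assms by (auto simp: coset_closed_def)
    show "t * int (q\<^sup>2) mod int n \<notin> S"
    proof
      assume a: "t * int (q\<^sup>2) mod int n \<in> S"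
      have "(t * int (q\<^sup>2) mod int n) * int ((q\<^sup>2) ^ (m - 1)) mod int n = t * int ((q\<^sup>2) ^ Suc (m - 1)) mod int n"
        by (simp add: mult_mod_mult_mod)
      also have "int ((q\<^sup>2) ^ Suc (m - 1)) = int n + 1"
        using m_pos by (simp flip: Suc_n)
      also have "t * (int n + 1) mod int n = t"
        using t assms by (auto simp: coset_closed_def algebra_simps subset_iff)
      finally show False
        using coset_closed_power[OF assms(1) a, of "m - 1"] t by simp
    qed
  qed
qed (use assms in \<open>auto simp: coset_closed_def\<close>)

lemma coset_closed_UNIV: "coset_closed {0..<int n}"
  using n_pos by (auto simp: coset_closed_def)

lemma coset_closed_Un: "coset_closed S \<Longrightarrow> coset_closed S' \<Longrightarrow> coset_closed (S \<union> S')"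
  by (auto simp: coset_closed_def)

section \<open>Sizes of cyclic codes\<close>

text \<open>The Frobenius map x -> x^(q^2) permutes the linear factors of \<open>g\<close>, since
  \<open>Z\<close> is closed under multiplication by q^2. Hence \<open>g\<close> has its
  coefficients in the base field, and its multiples by polynomials of degree less than |S| are
  distinct code words.\<close>

lemma card_code_ge:
  assumes "coset_closed S"
  shows "(q\<^sup>2) ^ card S \<le> card (code S)"
proof -
  let ?h = "\<lambda>x :: 'c. x ^ q\<^sup>2"
  define Z where "Z = {0..<int n} - S"
  define g where "g = (\<Prod>t\<in>Z. [:- (\<alpha> powi t), 1:])"
  have Z: "coset_closed Z" "finite Z"
    unfolding Z_def using coset_closed_Diff assms coset_closed_UNIV by auto
  have hom: "?h 0 = 0" "?h 1 = 1" "\<And>x y. ?h (x + y) = ?h x + ?h y" "\<And>x y. ?h (x * y) = ?h x * ?h y"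
    by (simp_all add: power_q2_add power_mult_distrib)
  have "map_poly ?h g = (\<Prod>t\<in>Z. [:- (\<alpha> powi (t * int (q\<^sup>2) mod int n)), 1:])"
    unfolding g_def map_poly_hom_prod[of ?h, OF hom]
  proof (rule prod.cong[OF refl])
    fix t
    have "?h (\<alpha> powi t) = \<alpha> powi (t * int (q\<^sup>2) mod int n)"
      unfolding powi_power powi_eq_iff by simp
    then show "map_poly ?h [:- (\<alpha> powi t), 1:] = [:- (\<alpha> powi (t * int (q\<^sup>2) mod int n)), 1:]"
      by (simp add: map_poly_pCons minus_power_q2)
  qed
  also have "\<dots> = g"
    unfolding g_def using prod.reindex_bij_betw[OF bij_mult_q2[OF Z(1)]] .
  finally have gh: "map_poly ?h g = g" .
  have g0: "g \<noteq> 0"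
    unfolding g_def using Z by simp
  have degg: "degree g = n - card S"
  proof -
    have "degree g = card Z"
      unfolding g_def by (subst degree_prod_eq_sum_degree) auto
    also have "\<dots> = n - card S"
      unfolding Z_def using assms by (subst card_Diff_subset) (auto simp: coset_closed_def finite_subset)
    finally show ?thesis .
  qed
  have cS: "card S \<le> n"
    using card_mono[of "{0..<int n}" S] assms by (auto simp: coset_closed_def)
  let ?H = "{c. (\<forall>i. coeff c i \<in> {x :: 'c. x ^ q\<^sup>2 = x}) \<and> (\<forall>i\<ge>card S. coeff c i = 0)}"
  have "(\<lambda>c. g * c) ` ?H \<subseteq> code S"
  proof
    fix d assume "d \<in> (\<lambda>c. g * c) ` ?H"
    then obtain c where d: "d = g * c" and c: "c \<in> ?H" by blast
    have "map_poly ?h c = c"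
      using c by (intro poly_eqI) (simp add: coeff_map_poly)
    then have "map_poly ?h d = d"
      unfolding d using gh map_poly_hom_mult[of ?h g c, OF hom(1,3,4)] by simp
    then have "coeff d i ^ q\<^sup>2 = coeff d i" for i
      using coeff_map_poly[of ?h d i] by simp
    moreover have "coeff d i = 0" if "i \<ge> n" for i
    proof (cases "c = 0")
      case False
      then have "degree c < card S"
        using c by (intro degree_less_if_coeffs_zero) auto
      then have "degree d < n"
        unfolding d using degg cS degree_mult_le[of g c] by linarith
      then show ?thesis using that by (simp add: coeff_eq_0)
    qed (simp add: d)
    moreover have "poly d (\<alpha> powi t) = 0" if "t \<in> Z" for t
      unfolding d g_def using that Z by (auto simp: poly_prod prod_zero_iff)
    ultimately show "d \<in> code S"
      by (simp add: code_def words_def Z_def)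
  qed
  then have "card ((\<lambda>c. g * c) ` ?H) \<le> card (code S)"
    by (intro card_mono finite_code)
  moreover have "inj_on (\<lambda>c. g * c) ?H"
    using g0 by (auto intro: inj_onI)
  ultimately show ?thesis
    using card_polys_coeffs_in(1)[OF finite_base, of "card S"] card_base by (simp add: card_image)
qed

lemma card_code:
  assumes "coset_closed S"
  shows "card (code S) = (q\<^sup>2) ^ card S"
proof -
  let ?S' = "{0..<int n} - S"
  have "inj_on (\<lambda>(c, d). c + d) (code S \<times> code ?S')"
  proof (rule inj_onI, clarify)
    fix c d c' d'
    assume a: "c \<in> code S" "d \<in> code ?S'" "c' \<in> code S" "d' \<in> code ?S'" "c + d = c' + d'"
    then have eq: "c - c' = d' - d" by (simp add: algebra_simps)
    have "c - c' \<in> code S" "c - c' \<in> code ?S'"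
      using a code_diff[of c S c'] code_diff[of d' ?S' d] by (simp_all add: eq)
    then have "c - c' = 0"
      by (intro words_eq_zeroI) (auto simp: code_def)
    then show "c = c' \<and> d = d'" using eq by simp
  qed
  then have "card (code S) * card (code ?S') = card ((\<lambda>(c, d). c + d) ` (code S \<times> code ?S'))"
    by (simp add: card_image card_cartesian_product)
  also have "\<dots> \<le> card words"
    using code_subset_words by (intro card_mono finite_words) (auto intro!: words_add simp: subset_iff)
  finally have le: "card (code S) * card (code ?S') \<le> (q\<^sup>2) ^ n"
    by (simp add: card_words)
  have sub: "S \<subseteq> {0..<int n}" "finite S"
    using assms finite_subset by (auto simp: coset_closed_def)
  have cS: "card S + card ?S' = n"
    using sub card_Un_disjoint[of S ?S'] by (simp add: Un_absorb1)
  have ge: "(q\<^sup>2) ^ card S \<le> card (code S)" "(q\<^sup>2) ^ card ?S' \<le> card (code ?S')"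
    using card_code_ge assms coset_closed_Diff[OF assms coset_closed_UNIV] by auto
  have "card (code S) * (q\<^sup>2) ^ card ?S' \<le> card (code S) * card (code ?S')"
    using ge by simp
  also have "\<dots> \<le> (q\<^sup>2) ^ card S * (q\<^sup>2) ^ card ?S'"
    using le by (simp only: cS flip: power_add)
  finally have "card (code S) \<le> (q\<^sup>2) ^ card S"
    using q_gt_1 by simp
  then show ?thesis using ge(1) by simp
qed

section \<open>Geometric sums and the BCH bound\<close>

text \<open>A sum of n ones is -1, because the characteristic divides n + 1 = q^(2m). This is why
  Fourier inversion below has the sign -1 in place of a factor 1/n.\<close>

lemma sum_powi_geometric:
  "(\<Sum>i<n. (\<alpha> powi t) ^ i) = (if t mod int n = 0 then - 1 else 0)"
proof (cases "t mod int n = 0")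
  case True
  then have "\<alpha> powi t = \<alpha> powi 0" unfolding powi_eq_iff by simp
  then show ?thesis using True of_nat_n by simp
next
  case False
  then have "\<alpha> powi t \<noteq> \<alpha> powi 0" unfolding powi_eq_iff by simp
  moreover have "(\<alpha> powi t) ^ n = \<alpha> powi 0"
    unfolding powi_power powi_eq_iff by simp
  ultimately show ?thesis using False by (simp add: geometric_sum)
qed

text \<open>The locator polynomial of all error positions but one turns the vanishing syndromes into
  a single nonzero term.\<close>

theorem bch_bound:
  assumes "c \<in> words" "c \<noteq> 0" "\<And>t. 1 \<le> t \<Longrightarrow> t < int \<delta> \<Longrightarrow> poly c (\<alpha> powi t) = 0"
  shows "\<delta> \<le> card {i. coeff c i \<noteq> 0}"
proof (rule ccontr)
  assume "\<not> \<delta> \<le> card {i. coeff c i \<noteq> 0}"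
  define I where "I = {i. coeff c i \<noteq> 0}"
  have I: "I \<subseteq> {..<n}" "finite I"
  proof -
    have "i < n" if "i \<in> I" for i
      using assms(1) that by (cases "i < n") (simp_all add: I_def words_def)
    then show "I \<subseteq> {..<n}" by blast
    then show "finite I" using finite_subset by blast
  qed
  obtain i0 where i0: "i0 \<in> I"
    using assms(2) by (auto simp: I_def poly_eq_iff)
  define \<Lambda> where "\<Lambda> = (\<Prod>i\<in>I - {i0}. [:- (\<alpha> powi int i), 1:])"
  have "degree \<Lambda> = card (I - {i0})"
    unfolding \<Lambda>_def by (subst degree_prod_eq_sum_degree) auto
  moreover have "card I < \<delta>"
    using \<open>\<not> \<delta> \<le> _\<close> by (simp add: I_def)
  moreover have "card (I - {i0}) < card I"
    using I(2) i0 by (rule card_Diff1_less)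
  ultimately have deg: "degree \<Lambda> + 1 < \<delta>" by simp
  \<comment> \<open>The extra factor \<alpha>^i shifts the syndromes: expanding
    \<open>\<Lambda>\<close> gives the values of \<open>c\<close> at \<alpha>^(j+1), so the
    exponents start at 1, like the prescribed zeros, and stay below \<delta>.\<close>
  have "(\<Sum>i<n. coeff c i * \<alpha> powi int i * poly \<Lambda> (\<alpha> powi int i)) =
      (\<Sum>i<n. \<Sum>j\<le>degree \<Lambda>. coeff \<Lambda> j * (coeff c i * (\<alpha> powi (int j + 1)) ^ i))"
  proof (rule sum.cong[OF refl])
    fix i
    have "\<alpha> powi int i * (\<alpha> powi int i) ^ j = (\<alpha> powi (int j + 1)) ^ i" for j
      unfolding powi_power by (simp add: algebra_simps power_int_add)
    then show "coeff c i * \<alpha> powi int i * poly \<Lambda> (\<alpha> powi int i) =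
       (\<Sum>j\<le>degree \<Lambda>. coeff \<Lambda> j * (coeff c i * (\<alpha> powi (int j + 1)) ^ i))"
      unfolding poly_altdef sum_distrib_left by (intro sum.cong) (simp_all add: ac_simps)
  qed
  also have "\<dots> = (\<Sum>j\<le>degree \<Lambda>. coeff \<Lambda> j * poly c (\<alpha> powi (int j + 1)))"
    by (subst sum.swap) (simp add: words_poly[OF assms(1)] sum_distrib_left)
  also have "\<dots> = 0"
    using deg assms(3) by (intro sum.neutral) auto
  also have "(\<Sum>i<n. coeff c i * \<alpha> powi int i * poly \<Lambda> (\<alpha> powi int i)) =
      (\<Sum>i\<in>{i0}. coeff c i * \<alpha> powi int i * poly \<Lambda> (\<alpha> powi int i))"
  proof (rule sum.mono_neutral_right)
    show "\<forall>i\<in>{..<n} - {i0}. coeff c i * \<alpha> powi int i * poly \<Lambda> (\<alpha> powi int i) = 0"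
      using I by (auto simp: \<Lambda>_def poly_prod I_def)
  qed (use I i0 in auto)
  finally have "poly \<Lambda> (\<alpha> powi int i0) = 0"
    using i0 by (simp add: I_def)
  then obtain i where "i \<in> I" "i \<noteq> i0" "\<alpha> powi int i0 = \<alpha> powi int i"
    using I by (auto simp: \<Lambda>_def poly_prod prod_zero_iff)
  moreover have "i < n" "i0 < n"
    using I i0 \<open>i \<in> I\<close> by auto
  moreover have "int i0 mod int n = int i mod int n"
    using \<open>\<alpha> powi int i0 = \<alpha> powi int i\<close> by (simp only: powi_eq_iff)
  ultimately show False
    using \<open>i \<noteq> i0\<close> by simp
qed

end

context bch_field
begin

section \<open>Duality\<close>

definition herm :: "'c poly \<Rightarrow> 'c poly \<Rightarrow> 'c" where
  "herm c d = (\<Sum>i<n. coeff c i * coeff d i ^ q)"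

text \<open>As q^2 = p^(2e), this is the absolute trace of the field with q^2 elements, extended to
  \<open>'c\<close> by the same polynomial.\<close>

definition trace :: "'c \<Rightarrow> 'c" where
  "trace x = (\<Sum>l<2 * e. x ^ (CHAR('c) ^ l))"

lemma trace_0 [simp]: "trace 0 = 0"
  using prime_gt_0_nat[OF char_prime] by (simp add: trace_def power_0_left)

lemma inverse_transform:
  assumes "c \<in> words" "i < n"
  shows "(\<Sum>t<n. poly c (\<alpha> powi int t) * \<alpha> powi (- (int t * int i))) = - coeff c i"
proof -
  have "(\<Sum>t<n. poly c (\<alpha> powi int t) * \<alpha> powi (- (int t * int i)))
      = (\<Sum>t<n. \<Sum>j<n. coeff c j * (\<alpha> powi (int j - int i)) ^ t)"
  proof (rule sum.cong[OF refl])
    fix t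
    have "(\<alpha> powi int t) ^ j * \<alpha> powi (- (int t * int i)) = (\<alpha> powi (int j - int i)) ^ t" for j
      unfolding powi_power by (subst power_int_add[symmetric]) (simp_all add: algebra_simps)
    then show "poly c (\<alpha> powi int t) * \<alpha> powi (- (int t * int i))
      = (\<Sum>j<n. coeff c j * (\<alpha> powi (int j - int i)) ^ t)"
      unfolding words_poly[OF assms(1)] sum_distrib_right by (simp only: mult.assoc)
  qed
  also have "\<dots> = (\<Sum>j<n. coeff c j * (\<Sum>t<n. (\<alpha> powi (int j - int i)) ^ t))"
    by (subst sum.swap) (simp only: sum_distrib_left)
  also have "\<dots> = (\<Sum>j<n. if j = i then - coeff c j else 0)"
  proof (rule sum.cong[OF refl])
    fix j assume j: "j \<in> {..<n}"
    have "(int j - int i) mod int n = 0 \<longleftrightarrow> j = i"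
    proof
      assume "(int j - int i) mod int n = 0"
      then have "int j mod int n = int i mod int n"
        by (simp add: mod_eq_dvd_iff mod_0_imp_dvd)
      then show "j = i" using j assms(2) by simp
    qed simp
    then show "coeff c j * (\<Sum>t<n. (\<alpha> powi (int j - int i)) ^ t) = (if j = i then - coeff c j else 0)"
      unfolding sum_powi_geometric by simp
  qed
  also have "\<dots> = - coeff c i"
    using assms(2) by simp
  finally show ?thesis .
qed

text \<open>The power q turns d_i^q back into d_i, which lies in F_{q^2}, and \<alpha>^(-t) into
  \<alpha>^(-qt). This is where S^{-q} in the description of the dual comes from.\<close>

lemma conjugate_transform_power:
  assumes "d \<in> words"
  shows "(\<Sum>i<n. coeff d i ^ q * (\<alpha> powi (- t)) ^ i) ^ q = poly d (\<alpha> powi (- int q * t))"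
proof -
  have "(coeff d i ^ q * (\<alpha> powi (- t)) ^ i) ^ q = coeff d i * (\<alpha> powi (- int q * t)) ^ i" for i
  proof -
    have "(coeff d i ^ q) ^ q = coeff d i"
      using assms by (simp add: words_def power2_eq_square flip: power_mult)
    moreover have "((\<alpha> powi (- t)) ^ i) ^ q = (\<alpha> powi (- int q * t)) ^ i"
      unfolding powi_power by (simp add: algebra_simps)
    ultimately show ?thesis by (simp add: power_mult_distrib)
  qed
  then show ?thesis
    unfolding sum_power_q words_poly[OF assms] by simp
qed

text \<open>Parseval: up to sign, \<open>herm c d\<close> is the sum over t of the transform of
  \<open>c\<close> at t times that of the conjugate word at -t, and the second factor vanishes
  exactly when \<open>d\<close> vanishes at \<alpha>^(-qt).\<close>

lemma herm_eq_zero: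
  assumes "c \<in> words" "d \<in> words"
    and disj: "\<And>t. t \<in> {0..<int n} \<Longrightarrow> poly c (\<alpha> powi t) = 0 \<or> poly d (\<alpha> powi (- int q * t)) = 0"
  shows "herm c d = 0"
proof -
  have "- herm c d = (\<Sum>i<n. (\<Sum>t<n. poly c (\<alpha> powi int t) * \<alpha> powi (- (int t * int i))) * coeff d i ^ q)"
    unfolding herm_def by (simp add: inverse_transform[OF assms(1)] sum_negf del: power_int_of_nat)
  also have "\<dots> = (\<Sum>i<n. \<Sum>t<n. poly c (\<alpha> powi int t) * (coeff d i ^ q * (\<alpha> powi (- int t)) ^ i))"
    unfolding sum_distrib_right powi_power by (simp add: ac_simps)
  also have "\<dots> = (\<Sum>t<n. poly c (\<alpha> powi int t) * (\<Sum>i<n. coeff d i ^ q * (\<alpha> powi (- int t)) ^ i))"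
    by (subst sum.swap) (simp only: sum_distrib_left)
  also have "\<dots> = 0"
  proof (rule sum.neutral, rule ballI)
    fix t assume "t \<in> {..<n}"
    then consider "poly c (\<alpha> powi int t) = 0" | "poly d (\<alpha> powi (- int q * int t)) = 0"
      using disj[of "int t"] by fastforce
    then show "poly c (\<alpha> powi int t) * (\<Sum>i<n. coeff d i ^ q * (\<alpha> powi (- int t)) ^ i) = 0"
    proof cases
      case 2
      then have "(\<Sum>i<n. coeff d i ^ q * (\<alpha> powi (- int t)) ^ i) ^ q = 0"
        unfolding conjugate_transform_power[OF assms(2)] .
      then have "(\<Sum>i<n. coeff d i ^ q * (\<alpha> powi (- int t)) ^ i) = 0"
        by (simp only: power_eq_0_iff)
      then show ?thesis by simp
    qed simp
  qed
  finally show ?thesis by simp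
qed

text \<open>For u in F_{q^(2m)}, coordinate i is the relative trace of u \<alpha>^(-is) down to
  F_{q^2}. These are the test words that force the zeros of a word in the dual.\<close>

definition trace_word :: "'c \<Rightarrow> int \<Rightarrow> 'c poly" where
  "trace_word u s = (\<Sum>i<n. monom (\<Sum>j<m. (u * \<alpha> powi (- (int i * s))) ^ ((q\<^sup>2) ^ j)) i)"

lemma coeff_trace_word:
  "coeff (trace_word u s) i = (if i < n then \<Sum>j<m. (u * \<alpha> powi (- (int i * s))) ^ ((q\<^sup>2) ^ j) else 0)"
  by (simp add: trace_word_def coeff_sum)

lemma relative_trace_power:
  assumes "(y :: 'c) ^ ((q\<^sup>2) ^ m) = y"
  shows "(\<Sum>j<m. y ^ ((q\<^sup>2) ^ j)) ^ q\<^sup>2 = (\<Sum>j<m. y ^ ((q\<^sup>2) ^ j))"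
proof -
  have "(\<Sum>j<m. y ^ ((q\<^sup>2) ^ j)) ^ q\<^sup>2 = (\<Sum>j<m. y ^ ((q\<^sup>2) ^ Suc j))"
    unfolding sum_power_q2[of _ _ 1, unfolded power_one_right] by (simp only: power_Suc2 power_mult)
  also have "\<dots> = (\<Sum>j<m. y ^ ((q\<^sup>2) ^ j))"
    using sum.lessThan_Suc[of "\<lambda>j. y ^ ((q\<^sup>2) ^ j)" m] sum.lessThan_Suc_shift[of "\<lambda>j. y ^ ((q\<^sup>2) ^ j)" m] assms
    by (simp add: add.commute)
  finally show ?thesis .
qed

text \<open>The transform at t splits into geometric sums with exponents t - s q^(2j); they all
  vanish unless t lies in the coset of s, which is contained in \<open>S\<close>.\<close>

lemma trace_word_in_code:
  assumes "coset_closed S" "s \<in> S" "u ^ ((q\<^sup>2) ^ m) = u"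
  shows "trace_word u s \<in> code S"
proof -
  have W: "trace_word u s \<in> words"
  proof -
    have "(u * \<alpha> powi t) ^ ((q\<^sup>2) ^ m) = u * \<alpha> powi t" for t
      by (simp only: power_mult_distrib powi_q2_m assms(3))
    then show ?thesis
      by (simp add: words_def coeff_trace_word relative_trace_power)
  qed
  moreover have "poly (trace_word u s) (\<alpha> powi t) = 0" if t: "t \<in> {0..<int n} - S" for t
  proof -
    have "poly (trace_word u s) (\<alpha> powi t)
        = (\<Sum>i<n. \<Sum>j<m. u ^ ((q\<^sup>2) ^ j) * (\<alpha> powi (t - s * int ((q\<^sup>2) ^ j))) ^ i)"
      unfolding words_poly[OF W]
    proof (rule sum.cong[OF refl])
      fix i assume i: "i \<in> {..<n}"
      have "(\<alpha> powi (- (int i * s))) ^ ((q\<^sup>2) ^ j) * (\<alpha> powi t) ^ i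
          = (\<alpha> powi (t - s * int ((q\<^sup>2) ^ j))) ^ i" for j
        unfolding powi_power by (subst power_int_add[symmetric]) (simp_all add: algebra_simps)
      then have "(u * \<alpha> powi (- (int i * s))) ^ ((q\<^sup>2) ^ j) * (\<alpha> powi t) ^ i
          = u ^ ((q\<^sup>2) ^ j) * (\<alpha> powi (t - s * int ((q\<^sup>2) ^ j))) ^ i" for j
        by (simp only: power_mult_distrib mult.assoc)
      then show "coeff (trace_word u s) i * (\<alpha> powi t) ^ i =
          (\<Sum>j<m. u ^ ((q\<^sup>2) ^ j) * (\<alpha> powi (t - s * int ((q\<^sup>2) ^ j))) ^ i)"
        using i by (simp only: coeff_trace_word sum_distrib_right lessThan_iff if_True)
    qed
    also have "\<dots> = (\<Sum>j<m. u ^ ((q\<^sup>2) ^ j) * (\<Sum>i<n. (\<alpha> powi (t - s * int ((q\<^sup>2) ^ j))) ^ i))"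
      by (subst sum.swap) (simp only: sum_distrib_left)
    also have "\<dots> = 0"
    proof (rule sum.neutral, rule ballI)
      fix j
      have "(t - s * int ((q\<^sup>2) ^ j)) mod int n \<noteq> 0"
      proof
        assume "(t - s * int ((q\<^sup>2) ^ j)) mod int n = 0"
        then have "t mod int n = s * int ((q\<^sup>2) ^ j) mod int n"
          by (simp only: mod_eq_dvd_iff mod_0_imp_dvd)
        then have "t \<in> S"
          using coset_closed_power[OF assms(1,2), of j] t by simp
        then show False using t by simp
      qed
      then show "u ^ ((q\<^sup>2) ^ j) * (\<Sum>i<n. (\<alpha> powi (t - s * int ((q\<^sup>2) ^ j))) ^ i) = 0"
        unfolding sum_powi_geometric by simp
    qed
    finally show ?thesis .
  qed
  ultimately show ?thesis by (simp add: code_def)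
qed

text \<open>The factors d_i^q are fixed by the power q^2 and move inside the relative trace; summing
  over i leaves the trace of \<open>u\<close> times one transform value of the conjugate
  word.\<close>

lemma herm_trace_word:
  assumes "d \<in> words"
  shows "herm (trace_word u s) d
       = (\<Sum>j<m. (u * (\<Sum>i<n. coeff d i ^ q * (\<alpha> powi (- s)) ^ i)) ^ ((q\<^sup>2) ^ j))"
proof -
  have d: "(coeff d i ^ q) ^ ((q\<^sup>2) ^ j) = coeff d i ^ q" for i j
  proof (rule base_power)
    have "(coeff d i ^ q) ^ q\<^sup>2 = (coeff d i ^ q\<^sup>2) ^ q"
      by (simp only: mult.commute flip: power_mult)
    then show "(coeff d i ^ q) ^ q\<^sup>2 = coeff d i ^ q"
      using assms by (simp add: words_def)
  qed
  have "herm (trace_word u s) d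
      = (\<Sum>i<n. \<Sum>j<m. (u * (coeff d i ^ q * (\<alpha> powi (- s)) ^ i)) ^ ((q\<^sup>2) ^ j))"
    unfolding herm_def
  proof (rule sum.cong[OF refl])
    fix i assume i: "i \<in> {..<n}"
    have "(u * \<alpha> powi (- (int i * s))) ^ ((q\<^sup>2) ^ j) * coeff d i ^ q
        = (u * (coeff d i ^ q * (\<alpha> powi (- s)) ^ i)) ^ ((q\<^sup>2) ^ j)" for j
    proof -
      have "(u * (coeff d i ^ q * (\<alpha> powi (- s)) ^ i)) ^ ((q\<^sup>2) ^ j)
          = (u * (\<alpha> powi (- s)) ^ i) ^ ((q\<^sup>2) ^ j) * (coeff d i ^ q) ^ ((q\<^sup>2) ^ j)"
        unfolding power_mult_distrib[symmetric] by (simp only: ac_simps)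
      then show ?thesis
        unfolding d powi_power by (simp add: mult.commute)
    qed
    then show "coeff (trace_word u s) i * coeff d i ^ q =
        (\<Sum>j<m. (u * (coeff d i ^ q * (\<alpha> powi (- s)) ^ i)) ^ ((q\<^sup>2) ^ j))"
      using i by (simp only: coeff_trace_word sum_distrib_right lessThan_iff if_True)
  qed
  also have "\<dots> = (\<Sum>j<m. (u * (\<Sum>i<n. coeff d i ^ q * (\<alpha> powi (- s)) ^ i)) ^ ((q\<^sup>2) ^ j))"
    by (subst sum.swap) (simp only: sum_distrib_left sum_power_q2)
  finally show ?thesis .
qed

text \<open>Transitivity of the trace: k = 2ej + l runs through all k < 2em exactly once.\<close>

lemma trace_relative_trace:
  "trace (\<Sum>j<m. x ^ ((q\<^sup>2) ^ j)) = (\<Sum>k<2 * e * m. x ^ (CHAR('c) ^ k))"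
proof -
  have "trace (\<Sum>j<m. x ^ ((q\<^sup>2) ^ j)) = (\<Sum>l<2 * e. \<Sum>j<m. x ^ (CHAR('c) ^ (2 * e * j + l)))"
    unfolding trace_def sum_power_char
    by (intro sum.cong refl) (simp add: q_eq power_add mult.commute flip: power_mult)
  also have "\<dots> = (\<Sum>j<m. \<Sum>l<2 * e. x ^ (CHAR('c) ^ (2 * e * j + l)))"
    by (rule sum.swap)
  also have "\<dots> = (\<Sum>j<m. \<Sum>k=j * (2 * e)..<j * (2 * e) + 2 * e. x ^ (CHAR('c) ^ k))"
  proof (rule sum.cong[OF refl])
    fix j
    show "(\<Sum>l<2 * e. x ^ (CHAR('c) ^ (2 * e * j + l)))
        = (\<Sum>k=j * (2 * e)..<j * (2 * e) + 2 * e. x ^ (CHAR('c) ^ k))"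
      by (rule sum.reindex_bij_witness[of _ "\<lambda>k. k - j * (2 * e)" "\<lambda>l. 2 * e * j + l"])
         (auto simp: mult.commute)
  qed
  also have "\<dots> = (\<Sum>k<m * (2 * e). x ^ (CHAR('c) ^ k))"
    by (rule sum.nat_group)
  finally show ?thesis by (simp add: ac_simps)
qed

text \<open>The absolute trace is a polynomial function of degree less than the size of the splitting
  field.\<close>

lemma trace_nondegenerate:
  assumes "(a :: 'c) \<noteq> 0"
  shows "\<exists>u. u ^ ((q\<^sup>2) ^ m) = u \<and> (\<Sum>k<2 * e * m. (a * u) ^ (CHAR('c) ^ k)) \<noteq> 0"
proof (rule ccontr)
  assume contr: "\<not> ?thesis"
  let ?M = "2 * e * m" and ?p = "CHAR('c)"
  have M: "?M > 0" using e_pos m_pos by simp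
  have p1: "?p > 1" using prime_gt_1_nat[OF char_prime] .
  have pM: "?p ^ ?M = Suc n"
    unfolding Suc_n q_eq by (simp add: ac_simps flip: power_mult)
  define P where "P = (\<Sum>k<?M. monom (a ^ (?p ^ k)) (?p ^ k))"
  have evalP: "poly P u = (\<Sum>k<?M. (a * u) ^ (?p ^ k))" for u
    by (simp add: P_def poly_sum poly_monom power_mult_distrib)
  have "degree P \<le> ?p ^ (?M - 1)"
    unfolding P_def
  proof (rule degree_sum_le)
    fix k assume "k \<in> {..<?M}"
    then have "?p ^ k \<le> ?p ^ (?M - 1)"
      using p1 by (intro power_increasing) auto
    then show "degree (monom (a ^ (?p ^ k)) (?p ^ k)) \<le> ?p ^ (?M - 1)"
      using degree_monom_le order_trans by blast
  qed simp
  also have "\<dots> < ?p ^ ?M"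
    using p1 M by (intro power_strict_increasing) auto
  finally have deg: "degree P < Suc n" by (simp only: pM)
  \<comment> \<open>The exponents p^k are pairwise distinct, so only one summand contributes to the
    top coefficient.\<close>
  have "coeff P (?p ^ (?M - 1)) = (\<Sum>k<?M. if k = ?M - 1 then a ^ (?p ^ k) else 0)"
    unfolding P_def coeff_sum coeff_monom
    using p1 by (intro sum.cong refl) (simp add: power_inject_exp)
  also have "\<dots> = a ^ (?p ^ (?M - 1))"
    using M by simp
  finally have P0: "P \<noteq> 0" using assms by auto
  \<comment> \<open>These n + 1 = q^(2m) points form F_{q^(2m)}: zero and the powers of
    \<alpha>.\<close>
  let ?L = "insert 0 ((\<lambda>t. \<alpha> powi t) ` {0..<int n})"
  have "inj_on (\<lambda>t. \<alpha> powi t) {0..<int n}"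
    by (auto simp: inj_on_def powi_eq_iff)
  then have "card ?L = Suc n"
    by (subst card_insert_disjoint) (auto simp: card_image)
  moreover have L: "?L \<subseteq> {u. poly P u = 0}"
  proof
    fix u assume "u \<in> ?L"
    then have "u ^ ((q\<^sup>2) ^ m) = u"
      using q_gt_1 by (auto simp: powi_q2_m)
    then show "u \<in> {u. poly P u = 0}"
      using contr by (simp add: evalP)
  qed
  ultimately have "Suc n \<le> card {u. poly P u = 0}"
    using card_mono[OF poly_roots_finite[OF P0] L] by simp
  also have "\<dots> \<le> degree P"
    by (rule card_poly_roots_bound[OF P0])
  finally have "Suc n \<le> degree P" .
  then show False using deg by simp
qed

text \<open>If a transform value of the conjugate word at some s in \<open>S\<close> were nonzero,
  nondegeneracy of the trace would supply a \<open>u\<close> whose test word is not orthogonal to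
  \<open>d\<close>. The scalar \<open>\<gamma>\<close> leaves room for the normalisation of the
  symplectic form.\<close>

theorem trace_dual_code:
  assumes "coset_closed S" "d \<in> words" "\<gamma> ^ q\<^sup>2 = \<gamma>" "\<gamma> \<noteq> 0"
  shows "(\<forall>c \<in> code S. trace (\<gamma> * herm c d) = 0) \<longleftrightarrow> d \<in> code ({0..<int n} - neg_q_image q n S)"
proof
  have powi_mod: "\<alpha> powi (t mod int n) = \<alpha> powi t" for t
    unfolding powi_eq_iff by simp
  {
    assume orth: "\<forall>c \<in> code S. trace (\<gamma> * herm c d) = 0"
    have "poly d (\<alpha> powi (- int q * s)) = 0" if s: "s \<in> S" for s
    proof -
      let ?A = "\<Sum>i<n. coeff d i ^ q * (\<alpha> powi (- s)) ^ i"
      have "?A = 0"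
      proof (rule ccontr)
        assume "?A \<noteq> 0"
        then obtain u where u: "u ^ ((q\<^sup>2) ^ m) = u"
            "(\<Sum>k<2 * e * m. (\<gamma> * ?A * u) ^ (CHAR('c) ^ k)) \<noteq> 0"
          using trace_nondegenerate[of "\<gamma> * ?A"] assms(4) by auto
        \<comment> \<open>Being fixed by the power q^2, \<open>\<gamma>\<close> passes into the
          relative trace.\<close>
        have "\<gamma> * herm (trace_word u s) d = (\<Sum>j<m. (\<gamma> * ?A * u) ^ ((q\<^sup>2) ^ j))"
        proof -
          have "\<gamma> * (u * a) ^ ((q\<^sup>2) ^ j) = (\<gamma> * a * u) ^ ((q\<^sup>2) ^ j)" for a j
            by (simp add: power_mult_distrib base_power[OF assms(3)])
          then show ?thesis
            unfolding herm_trace_word[OF assms(2)] by (subst sum_distrib_left) simp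
        qed
        moreover have "trace (\<gamma> * herm (trace_word u s) d) = 0"
          using orth trace_word_in_code[OF assms(1) s u(1)] by blast
        ultimately show False
          using u(2) by (simp only: trace_relative_trace)
      qed
      then show ?thesis
        using conjugate_transform_power[OF assms(2), of s] q_gt_1 by (simp only: power_0_left) simp
    qed
    then show "d \<in> code ({0..<int n} - neg_q_image q n S)"
      using assms(2) by (auto simp: code_def neg_q_image_def powi_mod)
  next
    assume d: "d \<in> code ({0..<int n} - neg_q_image q n S)"
    show "\<forall>c \<in> code S. trace (\<gamma> * herm c d) = 0"
    proof
      fix c assume c: "c \<in> code S"
      have "herm c d = 0"
      proof (rule herm_eq_zero)
        fix t assume t: "t \<in> {0..<int n}"
        show "poly c (\<alpha> powi t) = 0 \<or> poly d (\<alpha> powi (- int q * t)) = 0"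
        proof (cases "t \<in> S")
          case True
          then have "- int q * t mod int n \<in> neg_q_image q n S"
            by (auto simp: neg_q_image_def)
          then have "poly d (\<alpha> powi (- int q * t mod int n)) = 0"
            using d n_pos unfolding code_def by simp
          then show ?thesis unfolding powi_mod ..
        qed (use c t in \<open>simp add: code_def\<close>)
      qed (use c d in \<open>auto simp: code_def\<close>)
      then show "trace (\<gamma> * herm c d) = 0"
        by simp
    qed
  }
qed

end

section \<open>Cyclotomic cosets of small residues\<close>

locale small_residues =
  fixes q m n :: nat
  assumes q_gt_1: "q > 1" and m_pos: "m > 0" and n_eq: "n = q ^ (2 * m) - 1"
begin

lemma int_n: "int n = int q ^ (2 * m) - 1"
  using q_gt_1 by (simp add: n_eq of_nat_diff)

lemma int_le_power_minus_1:
  assumes "d \<le> q ^ m - 1"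
  shows "int d \<le> int q ^ m - 1"
proof -
  have "0 < q ^ m" using q_gt_1 by simp
  then have "Suc d \<le> q ^ m" using assms by linarith
  then have "int (Suc d) \<le> int (q ^ m)" by (simp only: of_nat_le_iff)
  then show ?thesis by (simp only: of_nat_Suc of_nat_power)
qed

lemma power_reduce: "[int q ^ l = int q ^ (l mod (2 * m))] (mod int n)"
proof -
  have "[(int q ^ (2 * m)) ^ (l div (2 * m)) * int q ^ (l mod (2 * m))
      = 1 ^ (l div (2 * m)) * int q ^ (l mod (2 * m))] (mod int n)"
    by (intro cong_mult cong_pow cong_refl) (simp add: cong_iff_dvd_diff int_n)
  then show ?thesis
    by (simp flip: power_mult power_add)
qed

text \<open>Since (q^m - 2) q^m = n + 1 - 2 q^m, a product with a power of q up to q^m stays so far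
  below n that a second residue below q^m can be added without wrapping around. The range \<delta>
  \<le> q^m - 1 gives exactly the bound q^m - 2 on residues.\<close>

lemma mult_power_less:
  assumes "0 < a" "a \<le> int q ^ m - 2" "k \<le> m"
  shows "a * int q ^ k + int q ^ m \<le> int n - 1"
proof -
  have "a * int q ^ k \<le> (int q ^ m - 2) * int q ^ m"
    using assms q_gt_1 by (intro mult_mono power_increasing) auto
  also have "\<dots> = int n + 1 - 2 * int q ^ m"
  proof -
    have "int q ^ (2 * m) = int q ^ m * int q ^ m"
      by (simp only: mult_2 power_add)
    then show ?thesis by (simp only: int_n left_diff_distrib)
  qed
  moreover have "int q ^ m \<ge> 2"
    using q_gt_1 m_pos self_le_power[of "int q" m] by linarith
  ultimately show ?thesis by linarith
qed

lemma not_dvd_add_small: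
  assumes "0 < a" "a \<le> int q ^ m - 2" "0 < b" "b \<le> int q ^ m - 2" "k \<le> m"
  shows "\<not> int n dvd a + b * int q ^ k"
proof -
  have "0 < b * int q ^ k" using assms q_gt_1 by simp
  then have "0 < a + b * int q ^ k" "a + b * int q ^ k < int n"
    using mult_power_less[OF assms(3-5)] assms by linarith+
  then show ?thesis by (rule zdvd_not_zless)
qed

text \<open>Exponents count modulo 2m. One above m is treated by multiplying with q^(2m-l), which
  exchanges \<open>a\<close> and \<open>b\<close> and brings the exponent below m, where the sum
  lies strictly between 0 and n.\<close>

lemma not_dvd_add:
  assumes "0 < a" "a \<le> int q ^ m - 2" "0 < b" "b \<le> int q ^ m - 2"
  shows "\<not> int n dvd a + b * int q ^ l"
proof
  let ?l = "l mod (2 * m)"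
  assume "int n dvd a + b * int q ^ l"
  moreover have "[a + b * int q ^ l = a + b * int q ^ ?l] (mod int n)"
    by (intro cong_add cong_mult cong_refl power_reduce)
  ultimately have d: "int n dvd a + b * int q ^ ?l"
    by (simp add: cong_dvd_iff)
  show False
  proof (cases "?l \<le> m")
    case True
    then show ?thesis using d not_dvd_add_small assms by blast
  next
    case False
    have l: "?l < 2 * m" using m_pos by simp
    have "int n dvd (a + b * int q ^ ?l) * int q ^ (2 * m - ?l)"
      using d by (rule dvd_mult2)
    also have "(a + b * int q ^ ?l) * int q ^ (2 * m - ?l) = (b + a * int q ^ (2 * m - ?l)) + b * int n"
      using l by (simp add: int_n algebra_simps flip: power_add)
    finally have "int n dvd b + a * int q ^ (2 * m - ?l)"
      by (simp add: dvd_add_left_iff)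
    then show ?thesis using not_dvd_add_small[OF assms(3,4,1,2), of "2 * m - ?l"] False by simp
  qed
qed

lemma mod_eq_imp_eq:
  assumes "0 < a" "a \<le> int q ^ m - 2" "0 < b" "b \<le> int q ^ m - 2" "k \<le> m"
    and "[a * int q ^ k = b] (mod int n)"
  shows "a * int q ^ k = b"
proof -
  have n0: "int q ^ m - 2 < int n"
    using mult_power_less[of a 0] assms by simp
  have "0 < a * int q ^ k" using assms q_gt_1 by simp
  then have "0 \<le> a * int q ^ k" "a * int q ^ k < int n" "0 \<le> b" "b < int n"
    using mult_power_less[OF assms(1,2,5)] assms n0 by linarith+
  then show ?thesis using assms(6) by (simp add: cong_def)
qed

text \<open>If 2i \<le> m, nothing wraps around and the congruence is an equation, so q^2 divides
  \<open>b\<close> unless i = 0. If 2i > m, multiplying by q^(2(m-i)) exchanges \<open>a\<close> and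
  \<open>b\<close>; the new exponent is positive, so q^2 would divide \<open>a\<close>.\<close>

lemma coset_leaders_distinct:
  assumes "0 < a" "a \<le> int q ^ m - 2" "0 < b" "b \<le> int q ^ m - 2"
    and "\<not> int (q\<^sup>2) dvd a" "\<not> int (q\<^sup>2) dvd b"
    and "i < m" "[a * int q ^ (2 * i) = b] (mod int n)"
  shows "i = 0 \<and> a = b"
proof (cases "2 * i \<le> m")
  case True
  then have eq: "a * int q ^ (2 * i) = b"
    using assms by (intro mod_eq_imp_eq) auto
  have "i = 0"
  proof (rule ccontr)
    assume "i \<noteq> 0"
    then have "int q ^ 2 dvd int q ^ (2 * i)" by (intro le_imp_power_dvd) auto
    then show False using assms(6) eq by auto
  qed
  then show ?thesis using eq by simp
next
  case False
  have "[a * int q ^ (2 * i) * int q ^ (2 * (m - i)) = b * int q ^ (2 * (m - i))] (mod int n)"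
    using assms(8) by (intro cong_mult cong_refl)
  moreover have "a * int q ^ (2 * i) * int q ^ (2 * (m - i)) = a * int q ^ (2 * m)"
  proof -
    have "2 * i + 2 * (m - i) = 2 * m" using assms(7) by simp
    then show ?thesis by (simp only: mult.assoc flip: power_add)
  qed
  moreover have "[a * int q ^ (2 * m) = a] (mod int n)"
  proof -
    have "a * int q ^ (2 * m) - a = a * int n" by (simp add: int_n algebra_simps)
    then show ?thesis by (simp add: cong_iff_dvd_diff)
  qed
  ultimately have "[b * int q ^ (2 * (m - i)) = a] (mod int n)"
    by (metis cong_sym cong_trans)
  then have eq: "b * int q ^ (2 * (m - i)) = a"
    using assms False by (intro mod_eq_imp_eq) auto
  have "int q ^ 2 dvd int q ^ (2 * (m - i))"
    using assms(7) by (intro le_imp_power_dvd) auto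
  then show ?thesis using assms(5) eq by auto
qed

lemma coset_elements_distinct:
  assumes "0 < a" "a \<le> int q ^ m - 2" "0 < b" "b \<le> int q ^ m - 2"
    and "\<not> int (q\<^sup>2) dvd a" "\<not> int (q\<^sup>2) dvd b"
    and "i < m" "j \<le> i" "[a * int q ^ (2 * i) = b * int q ^ (2 * j)] (mod int n)"
  shows "i = j \<and> a = b"
proof -
  have cop: "coprime (int q ^ (2 * j)) (int n)"
  proof -
    have "coprime (int q ^ (2 * m)) (int n)"
      unfolding int_n
    proof (rule coprimeI)
      fix c assume "c dvd int q ^ (2 * m)" "c dvd int q ^ (2 * m) - 1"
      then have "c dvd int q ^ (2 * m) - (int q ^ (2 * m) - 1)" by (rule dvd_diff)
      then show "is_unit c" by simp
    qed
    then show ?thesis using m_pos by simp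
  qed
  have "a * int q ^ (2 * i) = (a * int q ^ (2 * (i - j))) * int q ^ (2 * j)"
  proof -
    have "2 * i = 2 * (i - j) + 2 * j" using assms(8) by simp
    then show ?thesis by (simp only: mult.assoc flip: power_add)
  qed
  then have "[(a * int q ^ (2 * (i - j))) * int q ^ (2 * j) = b * int q ^ (2 * j)] (mod int n)"
    using assms(9) by (simp only:)
  then have "[a * int q ^ (2 * (i - j)) = b] (mod int n)"
    by (rule cong_mult_rcancel[OF cop, THEN iffD1])
  then show ?thesis
    using coset_leaders_distinct[OF assms(1-6), of "i - j"] assms(7,8) by auto
qed

text \<open>Each a is b q^(2s) with b \<le> a not divisible by q^2, and so lies in the coset of b.
  Pairs of such a b and an exponent below m enumerate the union without repetition; the subtracted
  term counts the multiples of q^2.\<close>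

lemma card_Union_cosets:
  assumes "2 \<le> \<delta>" "\<delta> \<le> q ^ m - 1"
  shows "card (\<Union>a \<in> {1..int \<delta> - 1}. cyc_coset q n a)
       = m * (\<delta> - 1 - (\<delta> - 1) div q\<^sup>2)"
proof -
  define A where "A = {a \<in> {1..int \<delta> - 1}. \<not> int (q\<^sup>2) dvd a}"
  define f where "f = (\<lambda>(a, i). a * int q ^ (2 * i) mod int n)"
  have \<delta>: "int \<delta> \<le> int q ^ m - 1"
    using assms(2) by (rule int_le_power_minus_1)
  have small: "0 < a" "a \<le> int q ^ m - 2" if "a \<in> A" for a
  proof -
    have "1 \<le> a" "a \<le> int \<delta> - 1" using that by (simp_all add: A_def)
    then show "0 < a" "a \<le> int q ^ m - 2" using \<delta> by linarith+
  qed
  have "(\<Union>a \<in> {1..int \<delta> - 1}. cyc_coset q n a) = f ` (A \<times> {..<m})"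
  proof (intro equalityI subsetI)
    fix x assume "x \<in> (\<Union>a \<in> {1..int \<delta> - 1}. cyc_coset q n a)"
    then obtain a i where a: "a \<in> {1..int \<delta> - 1}" and x: "x = a * int q ^ (2 * i) mod int n"
      by (auto simp: cyc_coset_def)
    have "\<not> is_unit (int (q\<^sup>2))" using q_gt_1 by (simp flip: of_nat_power)
    then obtain b where b: "a = int (q\<^sup>2) ^ multiplicity (int (q\<^sup>2)) a * b" "\<not> int (q\<^sup>2) dvd b"
      using multiplicity_decompose'[of a "int (q\<^sup>2)"] a by auto
    define s where "s = multiplicity (int (q\<^sup>2)) a"
    have as: "a = b * int q ^ (2 * s)"
      using b(1) by (simp add: s_def power_mult mult.commute)
    have "b > 0"
    proof (rule ccontr)
      assume "\<not> b > 0"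
      then have "a \<le> 0"
        unfolding as by (intro mult_nonpos_nonneg) auto
      then show False using a by simp
    qed
    moreover have "b \<le> a"
      using \<open>b > 0\<close> q_gt_1 unfolding as by (simp add: mult_le_cancel_left1)
    ultimately have "b \<in> A" using a b(2) by (auto simp: A_def)
    have "[int q ^ (2 * (s + i)) = int q ^ (2 * ((s + i) mod m))] (mod int n)"
      using power_reduce[of "2 * (s + i)"] by (simp add: mult_mod_right)
    then have "[b * int q ^ (2 * (s + i)) = b * int q ^ (2 * ((s + i) mod m))] (mod int n)"
      by (intro cong_mult cong_refl)
    moreover have "a * int q ^ (2 * i) = b * int q ^ (2 * (s + i))"
      unfolding as by (simp add: power_add algebra_simps)
    ultimately have "x = f (b, (s + i) mod m)"
      unfolding x f_def by (simp add: cong_def)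
    then show "x \<in> f ` (A \<times> {..<m})"
      using \<open>b \<in> A\<close> m_pos by auto
  qed (auto simp: f_def A_def cyc_coset_def)
  moreover have "inj_on f (A \<times> {..<m})"
  proof (rule inj_onI, clarify)
    fix a i b j assume h: "a \<in> A" "b \<in> A" "i < m" "j < m" "f (a, i) = f (b, j)"
    then have c: "[a * int q ^ (2 * i) = b * int q ^ (2 * j)] (mod int n)"
      by (simp add: f_def cong_def)
    have nd: "\<not> int (q\<^sup>2) dvd a" "\<not> int (q\<^sup>2) dvd b" using h by (auto simp: A_def)
    show "a = b \<and> i = j"
    proof (cases "j \<le> i")
      case True
      then show ?thesis
        using coset_elements_distinct[OF small[OF h(1)] small[OF h(2)] nd h(3) True c] by simp
    next
      case False
      then show ?thesis
        using coset_elements_distinct[OF small[OF h(2)] small[OF h(1)] nd(2,1) h(4) _ cong_sym[OF c]] by simp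
    qed
  qed
  moreover have "card A = \<delta> - 1 - (\<delta> - 1) div q\<^sup>2"
  proof -
    define M where "M = {a \<in> {1..int \<delta> - 1}. int (q\<^sup>2) dvd a}"
    have q2: "int (q\<^sup>2) > 0" using q_gt_1 by simp
    have "M = (\<lambda>c. int (q\<^sup>2) * c) ` {1..(int \<delta> - 1) div int (q\<^sup>2)}"
    proof (intro equalityI subsetI)
      fix x assume "x \<in> M"
      then obtain c where c: "x = int (q\<^sup>2) * c" "1 \<le> x" "x \<le> int \<delta> - 1"
        by (auto simp: M_def)
      then have "c > 0" using q2 zero_less_mult_pos[of "int (q\<^sup>2)" c] by linarith
      moreover have "c \<le> (int \<delta> - 1) div int (q\<^sup>2)"
        using c zdiv_mono1[of x "int \<delta> - 1" "int (q\<^sup>2)"] q2 by simp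
      ultimately show "x \<in> (\<lambda>c. int (q\<^sup>2) * c) ` {1..(int \<delta> - 1) div int (q\<^sup>2)}"
        using c(1) by auto
    next
      fix x assume "x \<in> (\<lambda>c. int (q\<^sup>2) * c) ` {1..(int \<delta> - 1) div int (q\<^sup>2)}"
      then obtain c where c: "x = int (q\<^sup>2) * c" "c \<in> {1..(int \<delta> - 1) div int (q\<^sup>2)}" by blast
      then have c: "x = int (q\<^sup>2) * c" "1 \<le> c" "c \<le> (int \<delta> - 1) div int (q\<^sup>2)" by simp_all
      have "x \<le> int (q\<^sup>2) * ((int \<delta> - 1) div int (q\<^sup>2))"
        unfolding c(1) using c(3) q2 by (intro mult_left_mono) auto
      also have "\<dots> \<le> int \<delta> - 1"
        using pos_mod_sign[OF q2, of "int \<delta> - 1"] mult_div_mod_eq[of "int (q\<^sup>2)" "int \<delta> - 1"] by linarith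
      finally have "x \<le> int \<delta> - 1" .
      moreover have "0 < x" unfolding c(1) using c(2) q2 by (intro mult_pos_pos) auto
      ultimately show "x \<in> M" using c(1) by (auto simp: M_def)
    qed
    then have "card M = card {1..(int \<delta> - 1) div int (q\<^sup>2)}"
      using q2 by (auto simp: card_image inj_on_def)
    also have "\<dots> = (\<delta> - 1) div q\<^sup>2"
    proof -
      have "int \<delta> - 1 = int (\<delta> - 1)" using assms(1) by simp
      then show ?thesis by (simp only: card_atLeastAtMost_int flip: zdiv_int)
    qed
    finally have "card M = (\<delta> - 1) div q\<^sup>2" .
    moreover have "A = {1..int \<delta> - 1} - M" by (auto simp: A_def M_def)
    moreover have "card ({1..int \<delta> - 1} - M) = card {1..int \<delta> - 1} - card M"
    proof (rule card_Diff_subset)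
      show "M \<subseteq> {1..int \<delta> - 1}" unfolding M_def by blast
      then show "finite M" by (rule finite_subset) simp
    qed
    ultimately show ?thesis using assms(1) by simp
  qed
  ultimately show ?thesis
    by (simp add: card_image card_cartesian_product mult.commute)
qed

lemma cosets_disjoint:
  assumes "2 \<le> \<delta>" "\<delta> \<le> q ^ m - 1"
  shows "(\<Union>a \<in> {1..int \<delta> - 1}. cyc_coset q n a) \<inter> (\<Union>a \<in> {1..int \<delta> - 1}. cyc_coset q n (- int q * a)) = {}"
proof (rule equals0I)
  fix x assume "x \<in> (\<Union>a \<in> {1..int \<delta> - 1}. cyc_coset q n a) \<inter> (\<Union>a \<in> {1..int \<delta> - 1}. cyc_coset q n (- int q * a))"
  then obtain a b where ab: "a \<in> {1..int \<delta> - 1}" "b \<in> {1..int \<delta> - 1}"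
    and "x \<in> cyc_coset q n a" "x \<in> cyc_coset q n (- int q * b)"
    by blast
  then obtain i j where x: "x = a * int q ^ (2 * i) mod int n"
      "x = - int q * b * int q ^ (2 * j) mod int n"
    unfolding cyc_coset_def by blast
  have \<delta>: "int \<delta> \<le> int q ^ m - 1"
    using assms(2) by (rule int_le_power_minus_1)
  \<comment> \<open>Multiplying by q^l completes q^(2i) to a power of q^(2m), which is 1 modulo n;
    what remains is a divisibility excluded by \<open>not_dvd_add\<close>.\<close>
  define l where "l = 2 * (m * i) - 2 * i"
  have le: "2 * i \<le> 2 * (m * i)" using m_pos by simp
  have c1: "[a * int q ^ (2 * i) * int q ^ l = - int q * b * int q ^ (2 * j) * int q ^ l] (mod int n)"
    by (rule cong_mult[OF _ cong_refl]) (simp only: cong_def x(2) flip: x(1))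
  have "2 * i + l = 2 * m * i" using le by (simp add: l_def)
  then have c2: "a * int q ^ (2 * i) * int q ^ l = a * int q ^ (2 * m * i)"
    by (simp only: mult.assoc flip: power_add)
  have "[a * int q ^ (2 * m * i) = a * 1] (mod int n)"
    using power_reduce[of "2 * m * i"] by (intro cong_mult cong_refl) simp
  then have "[a = - int q * b * int q ^ (2 * j) * int q ^ l] (mod int n)"
    using cong_trans[OF cong_sym c1[unfolded c2]] by (simp only: mult_1_right)
  then have "int n dvd a + b * int q ^ (1 + 2 * j + l)"
    by (simp add: cong_iff_dvd_diff power_add algebra_simps)
  moreover have "1 \<le> a" "a \<le> int \<delta> - 1" "1 \<le> b" "b \<le> int \<delta> - 1"
    using ab by simp_all
  then have "0 < a" "a \<le> int q ^ m - 2" "0 < b" "b \<le> int q ^ m - 2"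
    using \<delta> by linarith+
  ultimately show False
    using not_dvd_add by blast
qed

end

text \<open>The ceiling of N - N/q^2 is N minus the floor of N/q^2. With N = \<delta> - 1 the
  formula of the theorem becomes the number of coset leaders.\<close>

lemma ceiling_bch_dimension:
  assumes "\<delta> \<ge> 1" "q > 0"
  shows "nat \<lceil>(real \<delta> - 1) * (1 - 1 / (real q)\<^sup>2)\<rceil> = \<delta> - 1 - (\<delta> - 1) div q\<^sup>2"
proof -
  have "(real \<delta> - 1) * (1 - 1 / (real q)\<^sup>2) = real_of_int (int (\<delta> - 1)) - real (\<delta> - 1) / real (q\<^sup>2)"
    using assms by (simp add: of_nat_diff field_simps)
  also have "\<lceil>\<dots>\<rceil> = int (\<delta> - 1) - \<lfloor>real (\<delta> - 1) / real (q\<^sup>2)\<rfloor>"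
    unfolding diff_conv_add_uminus by (simp only: ceiling_add_of_int add.commute[of "real_of_int _"] ceiling_minus)
  also have "\<lfloor>real (\<delta> - 1) / real (q\<^sup>2)\<rfloor> = int ((\<delta> - 1) div q\<^sup>2)"
    by (rule floor_divide_of_nat_eq)
  finally show ?thesis
    by (simp add: nat_diff_distrib' nat_int)
qed

section \<open>From codes over the quadratic extension to symplectic codes\<close>

lemma abs_trace_eq:
  assumes "CARD('a :: finite_field) = CHAR('a) ^ e"
  shows "abs_trace (x :: 'a) = (\<Sum>i<e. x ^ (CHAR('a) ^ i))"
proof -
  have "CHAR('a) > 1" using prime_gt_1_nat[OF CHAR_prime] .
  then have "(THE e. CHAR('a) ^ e = CARD('a)) = e"
    unfolding assms by (intro the_equality) (auto simp: power_inject_exp)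
  then show ?thesis by (simp add: abs_trace_def)
qed

text \<open>The image of \<open>\<phi>\<close> is fixed by the power q, so \<open>beta_conj\<close>
  puts \<open>\<beta>\<close> outside it and makes 1, \<open>\<beta>\<close> a basis of F_{q^2} over
  that image.\<close>

locale symplectic_transfer = bch_field \<alpha> q m n e
  for \<alpha> :: "'c :: field" and q m n e :: nat +
  fixes \<phi> :: "'a :: finite_field \<Rightarrow> 'c" and \<beta> :: 'c
  assumes q_card: "q = CARD('a)" and char_eq: "CHAR('a) = CHAR('c)"
    and hom_0: "\<phi> 0 = 0" and hom_1: "\<phi> 1 = 1" and hom_add: "\<phi> (x + y) = \<phi> x + \<phi> y"
    and hom_mult: "\<phi> (x * y) = \<phi> x * \<phi> y" and hom_inj: "inj \<phi>"
    and beta_base: "\<beta> ^ q\<^sup>2 = \<beta>" and beta_conj: "\<beta> ^ q \<noteq> \<beta>"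
begin

lemma hom_power: "\<phi> (x ^ i) = \<phi> x ^ i"
  by (induction i) (simp_all add: hom_1 hom_mult)

lemma hom_uminus: "\<phi> (- x) = - \<phi> x"
  using hom_add[of x "- x"] by (simp add: hom_0 add_eq_0_iff)

lemma hom_diff: "\<phi> (x - y) = \<phi> x - \<phi> y"
  using hom_add[of x "- y"] by (simp add: hom_uminus)

lemma hom_sum: "\<phi> (sum f A) = (\<Sum>i\<in>A. \<phi> (f i))"
  by (induction A rule: infinite_finite_induct) (simp_all add: hom_0 hom_add)

lemma hom_eq_iff: "\<phi> x = \<phi> y \<longleftrightarrow> x = y"
  using hom_inj by (auto dest: injD)

lemma hom_eq_0_iff: "\<phi> x = 0 \<longleftrightarrow> x = 0"
  using hom_eq_iff[of x 0] by (simp add: hom_0)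

lemma power_q_add: "(x + y :: 'c) ^ q = x ^ q + y ^ q"
  by (rule freshmans_dream'[OF char_prime q_eq])

lemma hom_power_q: "\<phi> x ^ q = \<phi> x"
  using finite_field_power_card_eq_same[of x] by (simp add: q_card flip: hom_power)

definition pack :: "'a \<Rightarrow> 'a \<Rightarrow> 'c" where
  "pack x y = \<phi> x + \<beta> * \<phi> y"

lemma pack_power_q: "pack x y ^ q = \<phi> x + \<beta> ^ q * \<phi> y"
  by (simp add: pack_def power_q_add power_mult_distrib hom_power_q)

lemma pack_base: "pack x y ^ q\<^sup>2 = pack x y"
proof -
  have "\<phi> z ^ q\<^sup>2 = \<phi> z" for z
    by (simp add: power2_eq_square power_mult hom_power_q)
  then show ?thesis by (simp add: pack_def power_q2_add power_mult_distrib beta_base)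
qed

lemma pack_add: "pack (x + x') (y + y') = pack x y + pack x' y'"
  by (simp add: pack_def hom_add algebra_simps)

lemma pack_uminus: "pack (- x) (- y) = - pack x y"
  by (simp add: pack_def hom_uminus)

text \<open>The power q replaces \<open>\<beta>\<close> by its conjugate; comparing the two
  equations forces y = 0.\<close>

lemma pack_eq_0_iff: "pack x y = 0 \<longleftrightarrow> x = 0 \<and> y = 0"
proof
  assume p: "pack x y = 0"
  have "y = 0"
  proof (rule ccontr)
    assume "y \<noteq> 0"
    then have "\<phi> y \<noteq> 0" by (simp add: hom_eq_0_iff)
    have "\<phi> x + \<beta> ^ q * \<phi> y = 0"
      using p q_gt_1 by (simp flip: pack_power_q)
    then have "\<beta> ^ q * \<phi> y = \<beta> * \<phi> y"
      using p unfolding pack_def by (metis add_left_cancel)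
    then show False using \<open>\<phi> y \<noteq> 0\<close> beta_conj by simp
  qed
  then show "x = 0 \<and> y = 0" using p by (simp add: pack_def hom_0 hom_eq_0_iff)
qed (simp add: pack_def hom_0)

lemma pack_eq_iff: "pack x y = pack x' y' \<longleftrightarrow> x = x' \<and> y = y'"
proof -
  have "pack (x - x') (y - y') = pack x y - pack x' y'"
    by (simp add: pack_def hom_diff algebra_simps)
  then show ?thesis using pack_eq_0_iff[of "x - x'" "y - y'"] by auto
qed

lemma pack_surj:
  assumes "z ^ q\<^sup>2 = z"
  obtains x y where "z = pack x y"
proof -
  let ?f = "\<lambda>(x, y). pack x y"
  have "inj ?f"
    by (auto intro!: injI simp: pack_eq_iff)
  then have "card (range ?f) = q\<^sup>2"
    by (simp add: card_image q_card power2_eq_square flip: UNIV_Times_UNIV)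
  moreover have "range ?f \<subseteq> {x. x ^ q\<^sup>2 = x}"
    by (auto simp: pack_base)
  ultimately have "range ?f = {x. x ^ q\<^sup>2 = x}"
    using card_base finite_base by (intro card_subset_eq) simp_all
  then have "z \<in> range ?f" using assms by simp
  then obtain w where "z = ?f w" by blast
  then show ?thesis using that[of "fst w" "snd w"] by (simp add: case_prod_beta)
qed

definition word :: "'a vec \<times> 'a vec \<Rightarrow> 'c poly" where
  "word v = (\<Sum>i<n. monom (pack (fst v $ i) (snd v $ i)) i)"

lemma coeff_word: "coeff (word v) i = (if i < n then pack (fst v $ i) (snd v $ i) else 0)"
  by (simp add: word_def coeff_sum)

lemma bij_betw_word: "bij_betw word (sympl_space n) words"
  unfolding bij_betw_def
proof (intro conjI inj_onI equalityI subsetI)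
  fix u v assume uv: "u \<in> sympl_space n" "v \<in> sympl_space n" "word u = word v"
  have "pack (fst u $ i) (snd u $ i) = pack (fst v $ i) (snd v $ i)" if "i < n" for i
    using arg_cong[OF uv(3), of "\<lambda>p. coeff p i"] that by (simp add: coeff_word)
  then have "fst u $ i = fst v $ i" "snd u $ i = snd v $ i" if "i < n" for i
    using that by (simp_all add: pack_eq_iff)
  moreover have "dim_vec (fst u) = n" "dim_vec (fst v) = n" "dim_vec (snd u) = n" "dim_vec (snd v) = n"
    using uv(1,2) by (auto simp: sympl_space_def)
  ultimately show "u = v"
    by (intro prod_eqI eq_vecI) simp_all
next
  fix c assume "c \<in> word ` sympl_space n"
  then show "c \<in> words" using q_gt_1 by (auto simp: words_def coeff_word pack_base)
next
  fix c assume c: "c \<in> words"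
  then have "\<exists>x y. coeff c i = pack x y" for i
  proof -
    have "coeff c i ^ q\<^sup>2 = coeff c i" using c by (simp add: words_def)
    then show ?thesis by (rule pack_surj) blast
  qed
  then obtain f g where fg: "\<And>i. coeff c i = pack (f i) (g i)" by metis
  have "word (vec n f, vec n g) = c"
    using c by (intro poly_eqI) (simp add: coeff_word words_def flip: fg)
  moreover have "(vec n f, vec n g) \<in> sympl_space n"
    by (simp add: sympl_space_def)
  ultimately show "c \<in> word ` sympl_space n" by blast
qed

text \<open>Transitivity through F_q: the conjugates x^(p^l) and x^(p^(e+l)) pair up, and x + x^q is
  the relative trace.\<close>

lemma trace_eq_conjugate_sum:
  "trace x = (\<Sum>l<e. (x + x ^ q) ^ (CHAR('c) ^ l))"
proof -
  have split: "(\<Sum>l<a + b. f l) = (\<Sum>l<a. f l) + (\<Sum>l<b. f (a + l))" for f :: "nat \<Rightarrow> 'c" and a b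
    by (induction b) (simp_all add: add.assoc)
  have "trace x = (\<Sum>l<e. x ^ (CHAR('c) ^ l)) + (\<Sum>l<e. x ^ (CHAR('c) ^ (e + l)))"
    unfolding trace_def mult_2 by (rule split)
  also have "(\<Sum>l<e. x ^ (CHAR('c) ^ (e + l))) = (\<Sum>l<e. (x ^ q) ^ (CHAR('c) ^ l))"
    by (simp add: q_eq power_add power_mult)
  also have "(\<Sum>l<e. x ^ (CHAR('c) ^ l)) + \<dots> = (\<Sum>l<e. (x + x ^ q) ^ (CHAR('c) ^ l))"
    unfolding sum.distrib[symmetric] by (intro sum.cong refl) (rule freshmans_dream'[OF char_prime refl, symmetric])
  finally show ?thesis .
qed

text \<open>This scalar changes sign under the power q, so the relative trace of gamma x y^q is
  gamma (x y^q - x^q y), an alternating form. The inverse makes its value at x = \<beta>, y = 1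
  equal to 1.\<close>

definition gamma :: 'c where
  "gamma = inverse (\<beta> - \<beta> ^ q)"

lemma gamma_nonzero: "gamma \<noteq> 0"
  using beta_conj by (simp add: gamma_def)

lemma beta_conj_conj: "(\<beta> ^ q) ^ q = \<beta>"
  using beta_base by (simp add: power2_eq_square power_mult)

lemma gamma_power_q: "gamma ^ q = - gamma"
proof -
  have "(\<beta> - \<beta> ^ q) ^ q + (\<beta> ^ q) ^ q = \<beta> ^ q"
    using power_q_add[of "\<beta> - \<beta> ^ q" "\<beta> ^ q"] by simp
  then have "(\<beta> - \<beta> ^ q) ^ q = - (\<beta> - \<beta> ^ q)"
    by (simp add: beta_conj_conj algebra_simps)
  then show ?thesis by (simp add: gamma_def power_inverse flip: inverse_minus_eq)
qed

lemma uminus_power_q: "(- x :: 'c) ^ q = - (x ^ q)"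
proof -
  have "x ^ q + (- x) ^ q = 0"
    using q_gt_1 by (simp flip: power_q_add)
  then show ?thesis by (simp add: add_eq_0_iff)
qed

lemma gamma_base: "gamma ^ q\<^sup>2 = gamma"
  by (simp add: power2_eq_square power_mult gamma_power_q uminus_power_q)

lemma pack_symplectic:
  "gamma * (pack a b * pack a' b' ^ q) + (gamma * (pack a b * pack a' b' ^ q)) ^ q
   = \<phi> (a' * b - a * b')"
proof -
  have "(pack a' b' ^ q) ^ q = pack a' b'"
    using pack_base[of a' b'] by (simp add: power2_eq_square power_mult)
  then have "gamma * (pack a b * pack a' b' ^ q) + (gamma * (pack a b * pack a' b' ^ q)) ^ q
      = gamma * (pack a b * pack a' b' ^ q - pack a b ^ q * pack a' b')"
    by (simp add: power_mult_distrib gamma_power_q algebra_simps)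
  also have "pack a b * pack a' b' ^ q - pack a b ^ q * pack a' b'
      = (\<beta> - \<beta> ^ q) * (\<phi> a' * \<phi> b - \<phi> a * \<phi> b')"
    unfolding pack_power_q by (simp add: pack_def algebra_simps)
  also have "gamma * \<dots> = \<phi> a' * \<phi> b - \<phi> a * \<phi> b'"
    using beta_conj by (simp add: gamma_def)
  finally show ?thesis by (simp add: hom_diff hom_mult)
qed

text \<open>The trace factors through x + x^q, which coordinate by coordinate is the embedded
  symplectic product; the remaining e conjugates make up the absolute trace of F_q.\<close>

lemma hom_trace_symplectic:
  assumes "u \<in> sympl_space n" "v \<in> sympl_space n"
  shows "\<phi> (trace_symplectic u v) = trace (gamma * herm (word u) (word v))"
proof -
  let ?x = "gamma * herm (word u) (word v)"
  have dims: "dim_vec (fst u) = n" "dim_vec (snd u) = n" "dim_vec (fst v) = n" "dim_vec (snd v) = n"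
    using assms by (auto simp: sympl_space_def)
  define f where "f i = gamma * (pack (fst u $ i) (snd u $ i) * pack (fst v $ i) (snd v $ i) ^ q)" for i
  have x: "?x = (\<Sum>i<n. f i)"
    unfolding herm_def sum_distrib_left f_def by (intro sum.cong refl) (simp add: coeff_word)
  have "?x + ?x ^ q = (\<Sum>i<n. f i + f i ^ q)"
    unfolding x sum_power_q sum.distrib ..
  also have "\<dots> = \<phi> (\<Sum>i<n. fst v $ i * snd u $ i - fst u $ i * snd v $ i)"
    unfolding hom_sum f_def pack_symplectic ..
  also have "(\<Sum>i<n. fst v $ i * snd u $ i - fst u $ i * snd v $ i)
      = scalar_prod (fst v) (snd u) - scalar_prod (fst u) (snd v)"
    by (simp add: scalar_prod_def dims sum_subtractf lessThan_atLeast0)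
  finally have s: "?x + ?x ^ q = \<phi> (scalar_prod (fst v) (snd u) - scalar_prod (fst u) (snd v))" .
  have "CARD('a) = CHAR('a) ^ e"
    using q_eq q_card char_eq by simp
  then show ?thesis
    unfolding trace_eq_conjugate_sum s trace_symplectic_def
    by (simp add: abs_trace_eq hom_sum hom_power char_eq)
qed

definition sympl_code :: "int set \<Rightarrow> ('a vec \<times> 'a vec) set" where
  "sympl_code S = {v \<in> sympl_space n. word v \<in> code S}"

lemma bij_betw_word_code: "bij_betw word (sympl_code S) (code S)"
proof (rule bij_betw_subset[OF bij_betw_word])
  show "sympl_code S \<subseteq> sympl_space n" by (simp add: sympl_code_def Collect_conj_eq)
  show "word ` sympl_code S = code S"
  proof (intro equalityI subsetI)
    fix c assume "c \<in> code S"
    then have "c \<in> word ` sympl_space n"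
      using code_subset_words bij_betw_imp_surj_on[OF bij_betw_word] by auto
    then obtain v where "v \<in> sympl_space n" "c = word v" by (rule imageE)
    then show "c \<in> word ` sympl_code S"
      using \<open>c \<in> code S\<close> by (simp add: sympl_code_def)
  qed (auto simp: sympl_code_def)
qed

lemma sympl_dual_code:
  assumes "coset_closed S"
  shows "sympl_dual n (sympl_code S) = sympl_code ({0..<int n} - neg_q_image q n S)"
proof -
  have "(\<forall>u \<in> sympl_code S. trace_symplectic u v = 0)
      \<longleftrightarrow> word v \<in> code ({0..<int n} - neg_q_image q n S)"
    if v: "v \<in> sympl_space n" for v
  proof -
    have "word v \<in> words" using bij_betw_word v by (auto simp: bij_betw_def)
    have "(\<forall>u \<in> sympl_code S. trace_symplectic u v = 0)
      \<longleftrightarrow> (\<forall>u \<in> sympl_code S. trace (gamma * herm (word u) (word v)) = 0)"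
    proof (rule ball_cong[OF refl])
      fix u assume "u \<in> sympl_code S"
      then show "trace_symplectic u v = 0 \<longleftrightarrow> trace (gamma * herm (word u) (word v)) = 0"
        using hom_trace_symplectic[of u v] hom_eq_0_iff[of "trace_symplectic u v"] v
        by (simp add: sympl_code_def)
    qed
    also have "\<dots> \<longleftrightarrow> (\<forall>c \<in> word ` sympl_code S. trace (gamma * herm c (word v)) = 0)"
      by simp
    also have "word ` sympl_code S = code S"
      using bij_betw_word_code by (rule bij_betw_imp_surj_on)
    also have "(\<forall>c \<in> code S. trace (gamma * herm c (word v)) = 0)
        \<longleftrightarrow> word v \<in> code ({0..<int n} - neg_q_image q n S)"
      by (rule trace_dual_code) (fact assms \<open>word v \<in> words\<close> gamma_base gamma_nonzero)+
    finally show ?thesis .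
  qed
  then show ?thesis
    unfolding sympl_dual_def
    by (subst (2) sympl_code_def) (rule Collect_cong, rule conj_cong[OF refl])
qed

lemma card_sympl_code:
  assumes "coset_closed S"
  shows "card (sympl_code S) = (q\<^sup>2) ^ card S"
proof -
  have "card (sympl_code S) = card (code S)"
    by (rule bij_betw_same_card[OF bij_betw_word_code])
  then show ?thesis by (simp only: card_code[OF assms])
qed

lemma sympl_code_Int: "sympl_code S \<inter> sympl_code S' = sympl_code (S \<inter> S')"
  by (auto simp: sympl_code_def code_def)

lemma sympl_code_mono: "S \<subseteq> S' \<Longrightarrow> sympl_code S \<subseteq> sympl_code S'"
  by (auto simp: sympl_code_def code_def)

lemma additive_sympl_code: "additive_code n (sympl_code S)"
proof -
  have 0: "word (0\<^sub>v n, 0\<^sub>v n) = 0"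
    by (intro poly_eqI) (simp add: coeff_word pack_eq_0_iff)
  have add: "word (fst u + fst v, snd u + snd v) = word u + word v"
    if "u \<in> sympl_space n" "v \<in> sympl_space n" for u v
    using that by (intro poly_eqI) (auto simp: coeff_word sympl_space_def pack_add)
  have minus: "word (- fst u, - snd u) = 0 - word u" if "u \<in> sympl_space n" for u
    using that by (intro poly_eqI) (auto simp: coeff_word sympl_space_def pack_uminus)
  have mem: "u \<in> sympl_space n \<longleftrightarrow> fst u \<in> carrier_vec n \<and> snd u \<in> carrier_vec n" for u :: "'a vec \<times> 'a vec"
    by (simp add: sympl_space_def mem_Times_iff)
  show ?thesis
    unfolding additive_code_def
  proof (intro conjI ballI)
    show "(0\<^sub>v n, 0\<^sub>v n) \<in> sympl_code S"
      by (simp add: sympl_code_def mem 0 zero_in_code)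
    show "(fst u + fst v, snd u + snd v) \<in> sympl_code S" if "u \<in> sympl_code S" "v \<in> sympl_code S" for u v
      using that by (simp add: sympl_code_def add code_add) (simp add: mem)
    show "(- fst u, - snd u) \<in> sympl_code S" if "u \<in> sympl_code S" for u
      using that code_diff[OF zero_in_code, of "word u" S]
      by (simp only: sympl_code_def mem_Collect_eq minus) (simp add: mem)
  qed (auto simp: sympl_code_def)
qed

text \<open>A packed coordinate vanishes exactly when both components do, so the symplectic weight
  becomes a Hamming weight, to which the BCH bound applies.\<close>

lemma swt_word:
  assumes "v \<in> sympl_space n"
  shows "swt v = card {i. coeff (word v) i \<noteq> 0}"
proof -
  have "dim_vec (fst v) = n" using assms by (auto simp: sympl_space_def)
  then show ?thesis
    unfolding swt_def by (intro arg_cong[of _ _ card]) (auto simp: coeff_word pack_eq_0_iff)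
qed

lemma swt_sympl_code_ge:
  assumes "v \<in> sympl_code S" "v \<noteq> (0\<^sub>v n, 0\<^sub>v n)"
    and "\<And>t. 1 \<le> t \<Longrightarrow> t < int \<delta> \<Longrightarrow> t \<in> {0..<int n} - S"
  shows "\<delta> \<le> swt v"
proof -
  have v: "v \<in> sympl_space n" "word v \<in> code S" using assms(1) by (auto simp: sympl_code_def)
  have 0: "word (0\<^sub>v n, 0\<^sub>v n) = 0"
    by (intro poly_eqI) (simp add: coeff_word pack_eq_0_iff)
  have "(0\<^sub>v n, 0\<^sub>v n) \<in> (sympl_space n :: ('a vec \<times> 'a vec) set)" by (simp add: sympl_space_def)
  then have "word v \<noteq> 0"
    using assms(2) v(1) bij_betw_word 0 unfolding bij_betw_def inj_on_def by metis
  then have "\<delta> \<le> card {i. coeff (word v) i \<noteq> 0}"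
  proof (rule bch_bound[rotated])
    show "poly (word v) (\<alpha> powi t) = 0" if "1 \<le> t" "t < int \<delta>" for t
      using assms(3)[OF that] v(2) by (simp add: code_def)
  qed (use v code_subset_words in blast)
  then show ?thesis by (simp add: swt_word[OF v(1)])
qed

section \<open>The involution S -> S^{-q} and the subsystem code\<close>

lemma neg_q_image_neg_q_image:
  assumes "coset_closed S"
  shows "neg_q_image q n (neg_q_image q n S) = S"
proof -
  have "(- int q * (- int q * t mod int n)) mod int n = t * int (q\<^sup>2) mod int n" for t
    unfolding mod_mult_right_eq by (simp add: power2_eq_square algebra_simps)
  then have "neg_q_image q n (neg_q_image q n S) = (\<lambda>t. t * int (q\<^sup>2) mod int n) ` S"
    unfolding neg_q_image_def image_image by (intro image_cong refl)
  also have "\<dots> = S"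
    using bij_mult_q2[OF assms] by (simp add: bij_betw_def)
  finally show ?thesis .
qed

lemma coset_closed_neg_q_image:
  assumes "coset_closed S"
  shows "coset_closed (neg_q_image q n S)"
  unfolding coset_closed_def
proof (intro conjI ballI)
  show "neg_q_image q n S \<subseteq> {0..<int n}"
    using n_pos by (auto simp: neg_q_image_def)
  fix t assume "t \<in> neg_q_image q n S"
  then obtain s where s: "s \<in> S" "t = - int q * s mod int n" by (auto simp: neg_q_image_def)
  have "t * int (q\<^sup>2) mod int n = - int q * (s * int (q\<^sup>2) mod int n) mod int n"
    unfolding s(2) mod_mult_left_eq mod_mult_right_eq by (simp only: mult.assoc)
  moreover have "s * int (q\<^sup>2) mod int n \<in> S"
    using assms s(1) by (simp add: coset_closed_def)
  ultimately show "t * int (q\<^sup>2) mod int n \<in> neg_q_image q n S"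
    by (auto simp: neg_q_image_def)
qed

lemma card_neg_q_image:
  assumes "coset_closed S"
  shows "card (neg_q_image q n S) = card S"
proof -
  have fin: "finite S" "finite (neg_q_image q n S)"
    using assms finite_subset by (auto simp: coset_closed_def neg_q_image_def)
  have le: "card (neg_q_image q n A) \<le> card A" if "finite A" for A
    unfolding neg_q_image_def by (rule card_image_le[OF that])
  show ?thesis
    using le[OF fin(1)] le[OF fin(2)] by (simp add: neg_q_image_neg_q_image[OF assms])
qed

theorem subsystem_code_from_cyclic_codes:
  assumes Z: "coset_closed Z" and T: "coset_closed T"
    and ZZ: "Z \<inter> neg_q_image q n Z = {}" and TZ: "T \<inter> (Z \<union> neg_q_image q n Z) = {}"
    and range: "\<And>t. 1 \<le> t \<Longrightarrow> t < int \<delta> \<Longrightarrow> t \<in> Z"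
    and r: "r = card (T \<union> neg_q_image q n T)" and small: "r + 2 * card Z < n"
  shows "\<exists>d \<ge> \<delta>. subsystem_code_params_exists TYPE('a) n (n - 2 * card Z - r) r d"
proof -
  let ?neg = "neg_q_image q n"
  let ?N = "{0..<int n}"
  define U where "U = ?neg Z \<union> (T \<union> ?neg T)"
  have closed: "coset_closed (?neg Z)" "coset_closed (?neg T)" "coset_closed (T \<union> ?neg T)" "coset_closed U"
    unfolding U_def using Z T coset_closed_neg_q_image coset_closed_Un by simp_all
  have fin: "finite A" if "coset_closed A" for A
    using that finite_subset by (auto simp: coset_closed_def)
  have neg_Un: "?neg (A \<union> B) = ?neg A \<union> ?neg B" for A B
    by (auto simp: neg_q_image_def)
  have disj_neg: "?neg A \<inter> ?neg B = {}" if "A \<inter> B = {}" "coset_closed A" "coset_closed B" for A B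
  proof (rule equals0I)
    fix x assume "x \<in> ?neg A \<inter> ?neg B"
    then have "- int q * x mod int n \<in> ?neg (?neg A) \<inter> ?neg (?neg B)"
      by (auto simp: neg_q_image_def)
    then show False using that by (simp add: neg_q_image_neg_q_image)
  qed
  have negU: "?neg U = Z \<union> (T \<union> ?neg T)"
    unfolding U_def neg_Un neg_q_image_neg_q_image[OF Z] neg_q_image_neg_q_image[OF T] by blast
  \<comment> \<open>Both facts arise by applying the involution, to T \<inter> Z = {} and to T
    \<inter> Z^{-q} = {}.\<close>
  have TnegZ: "?neg T \<inter> ?neg Z = {}" "?neg T \<inter> Z = {}"
    using disj_neg[of T Z] disj_neg[of T "?neg Z"] TZ T Z closed
    by (auto simp: neg_q_image_neg_q_image)
  have cardU: "card U = card Z + r"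
    unfolding U_def r using TnegZ TZ fin closed T
    by (subst card_Un_disjoint) (simp_all add: card_neg_q_image[OF Z] Int_Un_distrib Int_commute Int_Un_distrib2)
  define G where "G = sympl_code U"
  define Y where "Y = G \<inter> sympl_dual n G"
  have "U \<inter> (?N - ?neg U) = ?neg Z"
    using ZZ TZ TnegZ closed(1) unfolding negU by (auto simp: U_def coset_closed_def)
  then have Y: "Y = sympl_code (?neg Z)"
    unfolding Y_def G_def sympl_dual_code[OF closed(4)] sympl_code_Int by simp
  then have dualY: "sympl_dual n Y = sympl_code (?N - Z)"
    using sympl_dual_code[OF closed(1)] neg_q_image_neg_q_image[OF Z] by simp
  have cardG: "card G = q ^ (2 * (card Z + r))"
    unfolding G_def card_sympl_code[OF closed(4)] cardU by (simp only: power_mult)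
  have cardY: "card Y = q ^ (2 * card Z)"
    unfolding Y card_sympl_code[OF closed(1)] card_neg_q_image[OF Z] by (simp only: power_mult)
  have cardD: "card (sympl_dual n Y) = q ^ (2 * (n - card Z))"
  proof -
    have "card (?N - Z) = n - card Z"
      using Z fin[OF Z] by (subst card_Diff_subset) (auto simp: coset_closed_def)
    then show ?thesis
      unfolding dualY card_sympl_code[OF coset_closed_Diff[OF Z coset_closed_UNIV]]
      by (simp only: power_mult)
  qed
  have GY: "G \<subseteq> sympl_dual n Y"
    unfolding G_def dualY using ZZ TZ TnegZ closed(4)
    by (intro sympl_code_mono) (auto simp: U_def coset_closed_def)
  \<comment> \<open>Here r + 2|Z| < n enters: \<open>G\<close> is a proper subset of the dual of
    \<open>Y\<close>, so the distance is taken over their difference.\<close>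
  have "card G < card (sympl_dual n Y)"
    unfolding cardG cardD using small q_gt_1 by (intro power_strict_increasing) auto
  then obtain w where w: "w \<in> sympl_dual n Y" "w \<notin> G"
    using GY by (metis less_irrefl subset_antisym subsetI)
  define W where "W = sympl_dual n Y - G - {(0\<^sub>v n, 0\<^sub>v n)}"
  have "(0\<^sub>v n, 0\<^sub>v n) \<in> G"
    using additive_sympl_code[of U] by (simp add: G_def additive_code_def)
  then have "W \<noteq> {}" using w by (auto simp: W_def)
  \<comment> \<open>Since \<open>W\<close> is nonempty, the infimum is the weight of an actual word,
    and a bound for each word bounds the distance.\<close>
  then have "Inf (swt ` W) \<in> swt ` W"
    by (intro Inf_nat_def1) simp
  then obtain v where v: "v \<in> W" "Inf (swt ` W) = swt v" by auto
  have d: "\<delta> \<le> min_swt n (sympl_dual n Y - G)"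
  proof -
    have "\<delta> \<le> swt v"
    proof (rule swt_sympl_code_ge)
      show "v \<in> sympl_code (?N - Z)" "v \<noteq> (0\<^sub>v n, 0\<^sub>v n)" using v(1) by (auto simp: W_def dualY)
      show "t \<in> ?N - (?N - Z)" if "1 \<le> t" "t < int \<delta>" for t
        using range[OF that] Z by (auto simp: coset_closed_def)
    qed
    then show ?thesis using v(2) by (simp add: min_swt_def W_def)
  qed
  have q0: "real q > 0" using q_gt_1 by simp
  have "subsystem_code_exists TYPE('a) n (CARD('a) ^ (n - 2 * card Z - r)) (CARD('a) ^ r)
      (min_swt n (sympl_dual n Y - G))"
    unfolding subsystem_code_exists_def Let_def q_card[symmetric]
  proof (intro conjI exI[of _ G])
    show "additive_code n G" unfolding G_def by (rule additive_sympl_code)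
    define k where "k = n - 2 * card Z - r"
    have n: "n = k + 2 * card Z + r" using small by (simp add: k_def)
    show "real (card G) = real q ^ n * real (q ^ r) / real (q ^ (n - 2 * card Z - r))"
    proof -
      \<comment> \<open>Cleared of its denominator, the required size is an equation between
        exponents of q.\<close>
      have "n + r = 2 * (card Z + r) + k" using n by simp
      then have "real q ^ n * real q ^ r = real q ^ (2 * (card Z + r)) * real q ^ k"
        by (simp only: flip: power_add)
      then show ?thesis
        unfolding k_def[symmetric] cardG using q0 by (simp add: field_simps)
    qed
    show "real (card (G \<inter> sympl_dual n G))
        = real q ^ n / (real (q ^ (n - 2 * card Z - r)) * real (q ^ r))"
    proof -
      have "n = 2 * card Z + (k + r)" using n by simp
      then have "real q ^ n = real q ^ (2 * card Z) * (real q ^ k * real q ^ r)"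
        by (simp only: flip: power_add)
      then show ?thesis
        unfolding k_def[symmetric] Y_def[symmetric] cardY using q0 by (simp add: field_simps)
    qed
    show "min_swt n (sympl_dual n Y - G) =
      (if sympl_dual n (G \<inter> sympl_dual n G) \<noteq> G then min_swt n (sympl_dual n (G \<inter> sympl_dual n G) - G)
       else min_swt n (sympl_dual n (G \<inter> sympl_dual n G)))"
      using w unfolding Y_def by auto
  qed (use q_gt_1 in auto)
  then show ?thesis
    using d unfolding subsystem_code_params_exists_def by blast
qed

end

section \<open>Fixed points, cosets and the choice of the fields\<close>

lemma card_power_eq_self_le:
  assumes "k \<ge> 2"
  shows "finite {x :: 'c :: field. x ^ k = x}" "card {x :: 'c. x ^ k = x} \<le> k"
proof -
  let ?P = "monom 1 k + monom (- 1) 1 :: 'c poly"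
  have deg: "degree ?P = k"
    using assms by (subst degree_add_eq_left) (auto simp: degree_monom_eq)
  then have P: "?P \<noteq> 0" using assms by auto
  have "{x :: 'c. x ^ k = x} = {x. poly ?P x = 0}"
    by (simp add: poly_monom)
  then show "finite {x :: 'c :: field. x ^ k = x}" "card {x :: 'c. x ^ k = x} \<le> k"
    using poly_roots_finite[OF P] card_poly_roots_bound[OF P] deg by simp_all
qed

text \<open>Counting roots gives the upper bound; the image of the injective map
  \<open>to_ac\<close> consists of fixed points and gives the lower one.\<close>

lemma card_power_CARD_eq_self:
  "card {x :: 'b :: finite_field alg_closure. x ^ CARD('b) = x} = CARD('b)"
proof (rule antisym)
  have "CARD('b) > 1"
    using card_mono[of UNIV "{0, 1 :: 'b}"] by simp
  then have *: "finite {x :: 'b alg_closure. x ^ CARD('b) = x}"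
      "card {x :: 'b alg_closure. x ^ CARD('b) = x} \<le> CARD('b)"
    using card_power_eq_self_le[of "CARD('b)", where ?'c = "'b alg_closure"] by simp_all
  then show "card {x :: 'b alg_closure. x ^ CARD('b) = x} \<le> CARD('b)" by simp
  have "range (to_ac :: 'b \<Rightarrow> _) \<subseteq> {x. x ^ CARD('b) = x}"
    by (auto simp: finite_field_power_card_eq_same simp flip: to_ac_power)
  then have "card (range (to_ac :: 'b \<Rightarrow> _)) \<le> card {x :: 'b alg_closure. x ^ CARD('b) = x}"
    by (rule card_mono[OF *(1)])
  then show "CARD('b) \<le> card {x :: 'b alg_closure. x ^ CARD('b) = x}"
    by (simp add: card_image[OF inj_to_ac])
qed

lemma (in bch_field) coset_closed_cyc_coset: "coset_closed (cyc_coset q n x)"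
  unfolding coset_closed_def
proof (intro conjI ballI)
  show "cyc_coset q n x \<subseteq> {0..<int n}"
    using n_pos by (auto simp: cyc_coset_def)
  fix t assume "t \<in> cyc_coset q n x"
  then obtain i where "t = x * int q ^ (2 * i) mod int n" by (auto simp: cyc_coset_def)
  then have "t * int (q\<^sup>2) mod int n = x * (int q ^ (2 * i) * int (q\<^sup>2)) mod int n"
    by (simp only: mult_mod_mult_mod)
  also have "int q ^ (2 * i) * int (q\<^sup>2) = int q ^ (2 * Suc i)"
    by (simp add: power2_eq_square)
  finally have "t * int (q\<^sup>2) mod int n = x * int q ^ (2 * Suc i) mod int n" .
  then show "t * int (q\<^sup>2) mod int n \<in> cyc_coset q n x"
    unfolding cyc_coset_def by blast
qed

lemma (in bch_field) coset_closed_Union: "(\<And>x. x \<in> A \<Longrightarrow> coset_closed (S x)) \<Longrightarrow> coset_closed (\<Union>x\<in>A. S x)"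
  unfolding coset_closed_def by blast

lemma neg_q_image_cyc_coset: "neg_q_image q n (cyc_coset q n x) = cyc_coset q n (- int q * x)"
proof -
  have "(- int q * (x * int q ^ (2 * i) mod int n)) mod int n = - int q * x * int q ^ (2 * i) mod int n" for i
    unfolding mod_mult_right_eq by (simp only: mult.assoc)
  moreover have "neg_q_image q n (cyc_coset q n x)
      = (\<lambda>i. (- int q * (x * int q ^ (2 * i) mod int n)) mod int n) ` UNIV"
    unfolding neg_q_image_def cyc_coset_def full_SetCompr_eq[symmetric] by blast
  ultimately show ?thesis
    unfolding cyc_coset_def by auto
qed

theorem corollary9:
  fixes q m n \<delta> k r :: nat
    and C :: "'b :: finite_field vec set"
    and T :: "int set"
  assumes "q = CARD('a :: finite_field)"
    and "m > 0" and "m \<noteq> 2"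
    and "n = q ^ (2 * m) - 1"
    and "2 \<le> \<delta>" and "\<delta> \<le> q ^ m - 1"
    and "primitive_narrow_sense_bch q m \<delta> C"
    and "k = m * nat \<lceil>(real \<delta> - 1) * (1 - 1 / (real q)\<^sup>2)\<rceil>"
    and "T \<subseteq> {0..<int n} -
           (\<Union>a \<in> {1..int \<delta> - 1}. cyc_coset q n a \<union> cyc_coset q n (- int q * a))"
    and "\<exists>S. T = (\<Union>x \<in> S. cyc_coset q n x)"
    and "r = card (T \<union> neg_q_image q n T)"
    and "0 \<le> r" and "int r < int n - 2 * int k"
  shows "\<exists>d \<ge> \<delta>. subsystem_code_params_exists TYPE('a)
           (q ^ (2 * m) - 1)
           (q ^ (2 * m) - 1 - 2 * m * nat \<lceil>(real \<delta> - 1) * (1 - 1 / (real q)\<^sup>2)\<rceil> - r)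
           r d"
proof -
  define Z where "Z = (\<Union>a \<in> {1..int \<delta> - 1}. cyc_coset q n a)"
  have card_b: "CARD('b) = q\<^sup>2"
    and "\<exists>\<alpha> :: 'b alg_closure. primitive_unity_root n \<alpha>"
    using assms(7) unfolding primitive_narrow_sense_bch_def Let_def assms(4) by blast+
  then obtain \<alpha> :: "'b alg_closure" where \<alpha>: "primitive_unity_root n \<alpha>" by blast
  obtain e where e: "CARD('a) = CHAR('a) ^ e" "e > 0"
    by (rule CARD_finite_field_CHAR_power)
  \<comment> \<open>The two field types are linked by their sizes, q and q^2; this forces equal
    characteristics, as the embedding requires.\<close>
  have "CHAR('a) dvd CARD('b)"
    unfolding card_b assms(1) e(1) using e(2) by (simp add: dvd_power flip: power_mult)
  then have char: "CHAR('a) = CHAR('b alg_closure)"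
    using prime_dvd_CARD_imp_CHAR[OF CHAR_prime[where ?'a = 'a]] by simp
  have q1: "q > 1"
    unfolding assms(1) using card_mono[of UNIV "{0, 1 :: 'a}"] by simp
  interpret small_residues q m n
    using q1 assms(2,4) by unfold_locales
  interpret bch_field \<alpha> q m n e
    using char e assms(1,2,4) \<alpha> card_power_CARD_eq_self[where ?'b = 'b] CHAR_prime[where ?'a = 'a]
    by unfold_locales (simp_all add: card_b)
  obtain \<phi> :: "'a \<Rightarrow> 'b alg_closure" where \<phi>: "\<phi> 0 = 0" "\<phi> 1 = 1" "\<And>x y. \<phi> (x + y) = \<phi> x + \<phi> y"
    "\<And>x y. \<phi> (x * y) = \<phi> x * \<phi> y" "inj \<phi>"
    using finite_field_embedding[OF char] by blast
  obtain \<beta> :: "'b alg_closure" where \<beta>: "\<beta> ^ q\<^sup>2 = \<beta>" "\<beta> ^ q \<noteq> \<beta>"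
  proof -
    \<comment> \<open>Counting yields \<open>\<beta>\<close>: there are q^2 solutions of x^(q^2) =
      x, but at most q of x^q = x.\<close>
    have "\<not> {x :: 'b alg_closure. x ^ q\<^sup>2 = x} \<subseteq> {x. x ^ q = x}"
    proof
      assume "{x :: 'b alg_closure. x ^ q\<^sup>2 = x} \<subseteq> {x. x ^ q = x}"
      moreover have "finite {x :: 'b alg_closure. x ^ q = x}"
        using q1 by (intro card_power_eq_self_le) simp
      ultimately have "card {x :: 'b alg_closure. x ^ q\<^sup>2 = x} \<le> card {x :: 'b alg_closure. x ^ q = x}"
        by (intro card_mono)
      then have "q\<^sup>2 \<le> card {x :: 'b alg_closure. x ^ q = x}"
        by (simp only: card_base)
      also have "\<dots> \<le> q"
        using q1 by (intro card_power_eq_self_le) simp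
      finally show False using q1 by (simp add: power2_eq_square)
    qed
    then show ?thesis using that by blast
  qed
  interpret symplectic_transfer \<alpha> q m n e \<phi> \<beta>
    using assms(1) char \<phi> \<beta> by unfold_locales
  have negZ: "neg_q_image q n Z = (\<Union>a \<in> {1..int \<delta> - 1}. cyc_coset q n (- int q * a))"
    unfolding Z_def neg_q_image_cyc_coset[symmetric] by (simp add: neg_q_image_def image_UN)
  have cardZ: "card Z = m * nat \<lceil>(real \<delta> - 1) * (1 - 1 / (real q)\<^sup>2)\<rceil>"
    using card_Union_cosets[OF assms(5,6)] ceiling_bch_dimension[of \<delta> q] assms(5) q1
    by (simp only: Z_def)
  have "\<exists>d \<ge> \<delta>. subsystem_code_params_exists TYPE('a) n (n - 2 * card Z - r) r d"
  proof (rule subsystem_code_from_cyclic_codes)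
    show "coset_closed Z"
      unfolding Z_def by (intro coset_closed_Union coset_closed_cyc_coset)
    show "coset_closed T"
    proof -
      obtain S where "T = (\<Union>x \<in> S. cyc_coset q n x)" using assms(10) by blast
      then show ?thesis by (simp only: coset_closed_Union coset_closed_cyc_coset)
    qed
    show "Z \<inter> neg_q_image q n Z = {}"
      unfolding negZ unfolding Z_def by (rule cosets_disjoint[OF assms(5,6)])
    show "T \<inter> (Z \<union> neg_q_image q n Z) = {}"
      using assms(9) unfolding negZ unfolding Z_def by blast
    show "t \<in> Z" if "1 \<le> t" "t < int \<delta>" for t
    proof -
      have "t \<le> int q ^ m - 2"
        using int_le_power_minus_1[OF assms(6)] that by linarith
      moreover have "0 < t" using that by simp
      ultimately have "t < int n"
        using mult_power_less[of t 0] q1 by (simp add: add_le_imp_le_left)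
      \<comment> \<open>As 0 < t < n, the residue t is already reduced and is the element of C_t
        with exponent 0.\<close>
      then have "t = t * int q ^ (2 * 0) mod int n"
        using that by simp
      then have "t \<in> cyc_coset q n t"
        unfolding cyc_coset_def by blast
      then show ?thesis unfolding Z_def using that by auto
    qed
    show "r + 2 * card Z < n"
      using assms(8,13) cardZ by linarith
  qed (fact assms(11))
  then show ?thesis
    unfolding cardZ assms(4) by (simp only: mult.assoc)
qed

end
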